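(* Let $G=G_\infty\times G_{\mathrm{fin}}$, $L_G$, $\mathcal{A}_G$ and $L\supseteq L_G$ be as defined in the context. Let $\mathcal{M}\in\mathrm{Str}^{\mathcal{A}_G}_{L_G,L}$, and suppose that $\mathcal{M}$ has almost-trivial definable closure. Then $\mathrm{Orb}_{L_G}(\mathcal{M})$ has a $G$-invariant probability measure.
   Context: Let $\ell_\infty$ and $\ell_0,\ell_1,\ell_2,\dots$ each be finite or countably infinite cardinals, $G_\infty:=S_\infty^{\ell_\infty}$, $G_{\mathrm{fin}}:=\prod_{n\in\mathbb{N}}S_n^{\ell_n}$, $G:=G_\infty\times G_{\mathrm{fin}}$, where $S_\infty$ is the symmetric group on $\mathbb{N}$ and $S_n$ the symmetric group on $n$ points. $L_G$ is the language of unary relation symbols $U_i^\infty$ ($1\le i\le\ell_\infty$), $U_i^n$ ($n\in\mathbb{N}$, $1\le i\le\ell_n$), $V_\infty$, $V_{\mathrm{fin}}$. Fix an $L_G$-structure $\mathcal{A}_G$ with underlying set $\mathbb{N}$ in which the sets $U_i^\infty$ are infinite and pairwise disjoint, the sets $U_i^n$ are pairwise disjoint with $|U_i^n|=n$, $V_\infty$ is the union of all $U_i^\infty$, $V_{\mathrm{fin}}$ is the union of all $U_i^n$ ($n\in\mathbb{N}$), and $V_{\mathrm{fin}}$ is the complement of $V_\infty$. The group $G$ is identified with $\mathrm{Aut}(\mathcal{A}_G)$, the group of permutations of $\mathbb{N}$ preserving each $U$-relation. $L$ is a fixed countable relational language extending $L_G$. $\mathrm{Str}^{\mathcal{A}_G}_{L_G,L}$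 is the set of $L$-structures with underlying set $\mathbb{N}$ whose restriction to $L_G$ equals $\mathcal{A}_G$, with the standard Borel structure generated by the sets $\{\mathcal{N}:\mathcal{N}\models R(n_1,\dots,n_k)\}$ for $R\in L$. $G=\mathrm{Aut}(\mathcal{A}_G)$ acts on it by the logic action: $g\cdot\mathcal{N}\models R(n_1,\dots,n_k)$ iff $\mathcal{N}\models R(g^{-1}(n_1),\dots,g^{-1}(n_k))$. $\mathrm{Orb}_{L_G}(\mathcal{M}):=\{\mathcal{N}\in\mathrm{Str}^{\mathcal{A}_G}_{L_G,L}:\mathcal{N}\cong\mathcal{M}\}$, which is the $G$-orbit of $\mathcal{M}$. A measure $\mu$ is $G$-invariant if $\mu(g\cdot X)=\mu(X)$ for all $g\in G$ and measurable $X$. For $X$ a subset of the underlying set of $\mathcal{M}$, $\mathrm{dcl}(X)$ is the set of all elements of $\mathcal{M}$ fixed by every automorphism of $\mathcal{M}$ that fixes $X$ pointwise. $\mathcal{M}$ has almost-trivial definable closure if for every finite tuple $\overline a\in\mathcal{M}$, $\mathrm{dcl}(\overline a\cup V_{\mathrm{fin}}^{\mathcal{A}_G})=\overline a\cup V_{\mathrm{fin}}^{\mathcal{A}_G}$. *)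

theory Defs
  imports "HOL-Probability.Probability" "HOL-Library.Extended_Nat"
begin

(* A relational language is the partial map sending each of its symbols to its arity.
   The underlying set of every structure is the type nat; a structure maps each symbol to the
   set of tuples (lists) satisfying it.  Symbols outside the language get the empty relation, so
   that two structures of a language are equal as functions iff they agree on its symbols. *)
type_synonym 's lang = "'s \<rightharpoonup> nat"
type_synonym 's fstruct = "'s \<Rightarrow> nat list set"

definition is_struct :: "'s lang \<Rightarrow> 's fstruct \<Rightarrow> bool" where
  "is_struct L N \<longleftrightarrow> (\<forall>R xs. xs \<in> N R \<longrightarrow> L R = Some (length xs))"

definition reduct :: "'s lang \<Rightarrow> 's fstruct \<Rightarrow> 's fstruct" where
  "reduct K N = (\<lambda>R. if R \<in> dom K then N R else {})"

definition is_iso :: "(nat \<Rightarrow> nat) \<Rightarrow> 's fstruct \<Rightarrow> 's fstruct \<Rightarrow> bool" where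
  "is_iso f M N \<longleftrightarrow> bij f \<and> (\<forall>R xs. xs \<in> M R \<longleftrightarrow> map f xs \<in> N R)"

definition Aut :: "'s fstruct \<Rightarrow> (nat \<Rightarrow> nat) set" where
  "Aut M = {f. is_iso f M M}"

definition dcl :: "'s fstruct \<Rightarrow> nat set \<Rightarrow> nat set" where
  "dcl M X = {b. \<forall>f\<in>Aut M. (\<forall>x\<in>X. f x = x) \<longrightarrow> f b = b}"

definition logic_act :: "(nat \<Rightarrow> nat) \<Rightarrow> 's fstruct \<Rightarrow> 's fstruct" where
  "logic_act g N = (\<lambda>R. {xs. map (inv g) xs \<in> N R})"

(* The subset of the underlying set named by a unary symbol. *)
definition ext :: "'s fstruct \<Rightarrow> 's \<Rightarrow> nat set" where
  "ext N R = {x. [x] \<in> N R}"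

(* Ufin n i is the i-th predicate naming a set of size n. The symbols Other r leave room for
   arbitrary further symbols in a language extending L_G. *)
datatype 'r symb = Uinf nat | Ufin nat nat | Vinf | Vfin | Other 'r

(* A cardinal that is finite or countably infinite is an enat; the infinite one gives all i >= 1. *)
definition idx :: "enat \<Rightarrow> nat set" where
  "idx l = {i. 1 \<le> i \<and> enat i \<le> l}"

definition L_G :: "enat \<Rightarrow> (nat \<Rightarrow> enat) \<Rightarrow> 'r symb lang" where
  "L_G linf lfin R = (case R of
      Uinf i \<Rightarrow> if i \<in> idx linf then Some 1 else None
    | Ufin n i \<Rightarrow> if i \<in> idx (lfin n) then Some 1 else None
    | Vinf \<Rightarrow> Some 1
    | Vfin \<Rightarrow> Some 1
    | Other r \<Rightarrow> None)"

definition is_A_G :: "enat \<Rightarrow> (nat \<Rightarrow> enat) \<Rightarrow> 'r symb fstruct \<Rightarrow> bool" where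
  "is_A_G linf lfin A \<longleftrightarrow>
     is_struct (L_G linf lfin) A \<and>
     (\<forall>i\<in>idx linf. infinite (ext A (Uinf i))) \<and>
     disjoint_family_on (\<lambda>i. ext A (Uinf i)) (idx linf) \<and>
     (\<forall>n. \<forall>i\<in>idx (lfin n). finite (ext A (Ufin n i)) \<and> card (ext A (Ufin n i)) = n) \<and>
     disjoint_family_on (\<lambda>(n, i). ext A (Ufin n i)) (SIGMA n:UNIV. idx (lfin n)) \<and>
     ext A Vinf = (\<Union>i\<in>idx linf. ext A (Uinf i)) \<and>
     ext A Vfin = (\<Union>n. \<Union>i\<in>idx (lfin n). ext A (Ufin n i)) \<and>
     ext A Vfin = - ext A Vinf"

(* The structures of the language L on nat whose reduct to K is A, and the Borel structure
   on this set. *)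
definition Str :: "'s lang \<Rightarrow> 's fstruct \<Rightarrow> 's lang \<Rightarrow> 's fstruct set" where
  "Str K A L = {N. is_struct L N \<and> reduct K N = A}"

definition Str_borel :: "'s lang \<Rightarrow> 's fstruct \<Rightarrow> 's lang \<Rightarrow> 's fstruct measure" where
  "Str_borel K A L =
     sigma (Str K A L) {{N \<in> Str K A L. xs \<in> N R} | R xs. L R = Some (length xs)}"

definition Orb :: "'s lang \<Rightarrow> 's fstruct \<Rightarrow> 's lang \<Rightarrow> 's fstruct \<Rightarrow> 's fstruct set" where
  "Orb K A L M = {N \<in> Str K A L. \<exists>f. is_iso f N M}"

(* The subspace Borel structure: the sets are the traces X Int Orb of Borel sets X. *)
definition Orb_borel :: "'s lang \<Rightarrow> 's fstruct \<Rightarrow> 's lang \<Rightarrow> 's fstruct \<Rightarrow> 's fstruct measure" where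
  "Orb_borel K A L M = restrict_space (Str_borel K A L) (Orb K A L M)"

definition almost_trivial_dcl :: "'r symb fstruct \<Rightarrow> 'r symb fstruct \<Rightarrow> bool" where
  "almost_trivial_dcl A M \<longleftrightarrow>
     (\<forall>a :: nat list. dcl M (set a \<union> ext A Vfin) = set a \<union> ext A Vfin)"

definition invariant_measure :: "(nat \<Rightarrow> nat) set \<Rightarrow> 's fstruct measure \<Rightarrow> bool" where
  "invariant_measure G \<mu> \<longleftrightarrow>
     (\<forall>g\<in>G. \<forall>X\<in>sets \<mu>. emeasure \<mu> (logic_act g ` X) = emeasure \<mu> X)"

(* A permutation preserving the U-relations preserves V_inf and V_fin as well, so the group G,
   identified with the permutations preserving each U-relation, is the full Aut A. *)
lemma Aut_A_G_eq:
  assumes A: "is_A_G linf lfin A"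
  shows "Aut A = {g. bij g \<and> (\<forall>i\<in>idx linf. g ` ext A (Uinf i) = ext A (Uinf i)) \<and>
     (\<forall>n. \<forall>i\<in>idx (lfin n). g ` ext A (Ufin n i) = ext A (Ufin n i))}" (is "_ = ?G")
proof (intro equalityI subsetI)
  fix g assume g: "g \<in> Aut A"
  then have b: "bij g" and p: "\<And>R xs. xs \<in> A R \<longleftrightarrow> map g xs \<in> A R"
    by (auto simp: Aut_def is_iso_def)
  have e: "x \<in> ext A R \<longleftrightarrow> g x \<in> ext A R" for x R
    using p[of "[x]" R] by (simp add: ext_def)
  have "g ` ext A R = ext A R" for R
  proof (intro equalityI subsetI)
    fix y assume y: "y \<in> ext A R"
    obtain x where "y = g x" using b by (metis bij_pointE)
    then show "y \<in> g ` ext A R" using e y by auto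
  qed (use e in auto)
  then show "g \<in> ?G" using b by auto
next
  fix g assume g: "g \<in> ?G"
  then have b: "bij g" by auto
  have st: "is_struct (L_G linf lfin) A"
    and Vi: "ext A Vinf = (\<Union>i\<in>idx linf. ext A (Uinf i))"
    and Vf: "ext A Vfin = (\<Union>n. \<Union>i\<in>idx (lfin n). ext A (Ufin n i))"
    using A by (auto simp: is_A_G_def)
  have im: "g ` ext A R = ext A R" if "R \<in> dom (L_G linf lfin)" for R
  proof (cases R)
    case Vinf
    then show ?thesis using g unfolding Vinf Vi image_UN by auto
  next
    case Vfin
    then show ?thesis using g unfolding Vfin Vf image_UN by auto
  next
    case (Uinf i)
    then have "i \<in> idx linf" using that by (auto simp: L_G_def split: if_splits)
    then show ?thesis using g Uinf by blast
  next
    case (Ufin n i)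
    then have "i \<in> idx (lfin n)" using that by (auto simp: L_G_def split: if_splits)
    then show ?thesis using g Ufin by blast
  next
    case (Other r)
    then show ?thesis using that by (auto simp: L_G_def)
  qed
  have ar: "length xs = 1" if "L_G linf lfin R = Some (length xs)" for R :: "'a symb" and xs :: "nat list"
    using that by (auto simp: L_G_def split: symb.splits if_splits)
  have "xs \<in> A R \<longleftrightarrow> map g xs \<in> A R" for R xs
  proof (cases "L_G linf lfin R = Some (length xs)")
    case True
    then obtain x where x: "xs = [x]" using ar by (metis One_nat_def length_0_conv length_Suc_conv)
    have "x \<in> ext A R \<longleftrightarrow> g x \<in> ext A R"
      using im[of R] True b by (metis bij_is_inj domI inj_image_mem_iff)
    then show ?thesis by (simp add: x ext_def)
  next
    case False
    then show ?thesis using st unfolding is_struct_def by (metis length_map)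
  qed
  then show "g \<in> Aut A" using b by (simp add: Aut_def is_iso_def)
qed

(* Orb is the orbit of M under the logic action of Aut A. *)
lemma Orb_eq_orbit:
  assumes M: "M \<in> Str K A L"
  shows "Orb K A L M = (\<lambda>g. logic_act g M) ` Aut A"
proof (intro equalityI subsetI)
  fix N assume "N \<in> Orb K A L M"
  then obtain f where N: "N \<in> Str K A L" and b: "bij f"
    and f: "\<And>R xs. xs \<in> N R \<longleftrightarrow> map f xs \<in> M R"
    by (auto simp: Orb_def is_iso_def)
  have "N = logic_act (inv f) M"
    using f b by (simp add: logic_act_def inv_inv_eq fun_eq_iff set_eq_iff)
  moreover have "inv f \<in> Aut A"
  proof -
    have "xs \<in> A R \<longleftrightarrow> map (inv f) xs \<in> A R" for R xs
    proof -
      have "reduct K M = A" "reduct K N = A" using M N by (auto simp: Str_def)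
      then have "A R = reduct K M R" "A R = reduct K N R" by auto
      then have "A R = (if R \<in> dom K then M R else {})" "A R = (if R \<in> dom K then N R else {})"
        by (simp_all only: reduct_def)
      moreover have "map f (map (inv f) xs) = xs"
        using b by (simp add: bij_is_surj map_idI surj_f_inv_f)
      ultimately show ?thesis using f[of "map (inv f) xs" R] by (cases "R \<in> dom K") (simp_all only: if_True if_False empty_iff)
    qed
    then show ?thesis using b by (simp add: Aut_def is_iso_def bij_imp_bij_inv)
  qed
  ultimately show "N \<in> (\<lambda>g. logic_act g M) ` Aut A" by blast
next
  fix N assume "N \<in> (\<lambda>g. logic_act g M) ` Aut A"
  then obtain g where N: "N = logic_act g M" and b: "bij g"
    and g: "\<And>R xs. xs \<in> A R \<longleftrightarrow> map g xs \<in> A R" by (auto simp: Aut_def is_iso_def)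
  have s: "is_struct L M" and r: "\<And>R. A R = (if R \<in> dom K then M R else {})"
    using M unfolding Str_def reduct_def by blast+
  have gi: "map g (map (inv g) xs) = xs" for xs
    using b by (simp add: bij_is_surj map_idI surj_f_inv_f)
  have "is_struct L N"
    using s unfolding is_struct_def N logic_act_def by (metis length_map mem_Collect_eq)
  moreover have "reduct K N = A"
  proof
    fix R
    have g': "map (inv g) xs \<in> A R \<longleftrightarrow> xs \<in> A R" for xs
      using g[of "map (inv g) xs" R] by (simp only: gi)
    show "reduct K N R = A R"
    proof (cases "R \<in> dom K")
      case True
      then have "A R = M R" using r[of R] by (simp only: if_True)
      then show ?thesis using True g' by (auto simp only: reduct_def N logic_act_def if_True)
    next
      case False
      then show ?thesis using r[of R] by (simp only: reduct_def if_False)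
    qed
  qed
  moreover have "is_iso (inv g) N M"
    using b by (simp add: is_iso_def N logic_act_def bij_imp_bij_inv)
  ultimately show "N \<in> Orb K A L M" by (auto simp: Orb_def Str_def)
qed

end

(* Let H be the group of automorphisms of M that fix V_fin pointwise. Almost-trivial definable
   closure says that every point of V_inf can be moved by some h in H that fixes any given finite set
   of other points. Hence the points of a finite set A can be duplicated independently of one another:
   whichever points are replaced by their duplicates, the result is still an H-translate of A.

   Build finite sets A_0, A_1, ... closing off alternately under duplicates and under realizations of
   one-point extensions. Every index i in V_inf performs a random walk, driven by its own independent
   sequence of draws: it waits outside A_n, is then thrown into A_n at a point of its own U-class, and
   from there on flips a coin at each stage to choose between its present position and the duplicate.
   Walks of different indices almost surely separate, and after separation the H-orbit of a finite
   tuple of positions does not change any more. So the positions define a limit structure, and a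
   back-and-forth argument along a generic outcome shows that it is isomorphic to M. An index in V_fin
   is placed once and for all by a uniformly random permutation of its finite U-class. The walks depend
   on the index only through its draws and its class, so the law of the limit is invariant under G. *)
theory Submission
  imports Defs
begin

section \<open>Independent draws\<close>

text \<open>The first \<open>K\<close> events all fail with probability at most
  \<open>(1 - c) ^ K\<close>, which tends to 0.\<close>

lemma (in prob_space) indep_events_AE_ex:
  fixes F :: "nat \<Rightarrow> 'a set"
  assumes ind: "indep_events F UNIV" and c: "c > 0" "\<And>k. prob (F k) \<ge> c"
  shows "AE x in M. \<exists>k. x \<in> F k"
proof -
  have F[measurable]: "F k \<in> events" for k using ind by (auto simp: indep_events_def)
  define N where "N K = {x \<in> space M. \<forall>k<K. x \<notin> F k}" for K
  have N[measurable]: "N K \<in> events" for K unfolding N_def by measurable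
  have FJ[measurable]: "{x \<in> space M. \<forall>j\<in>J. x \<in> F j} \<in> events" if "finite J" for J
    using that by measurable
  \<comment> \<open>The events indexed by \<open>J\<close> are carried along for the induction:
    failure of \<open>F K\<close> is the difference between no condition on \<open>F K\<close> and
    its occurrence, and the latter moves \<open>K\<close> into \<open>J\<close>.\<close>
  have main: "prob (N K \<inter> {x \<in> space M. \<forall>j\<in>J. x \<in> F j}) = (\<Prod>k<K. 1 - prob (F k)) * (\<Prod>j\<in>J. prob (F j))"
    if "finite J" "J \<inter> {..<K} = {}" for J K
    using that
  proof (induction K arbitrary: J)
    case 0
    show ?case
    proof (cases "J = {}")
      case True
      then show ?thesis by (simp add: N_def prob_space)
    next
      case False
      have "N 0 \<inter> {x \<in> space M. \<forall>j\<in>J. x \<in> F j} = (\<Inter>j\<in>J. F j)"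
        using False sets.sets_into_space[OF F] by (auto simp: N_def)
      then show ?thesis using ind False 0 by (simp add: indep_events_def)
    qed
  next
    case (Suc K)
    let ?X = "\<lambda>J. {x \<in> space M. \<forall>j\<in>J. x \<in> F j}"
    have "N (Suc K) \<inter> ?X J = N K \<inter> ?X J - N K \<inter> ?X (insert K J)"
      by (auto simp: N_def less_Suc_eq)
    moreover have "prob (N K \<inter> ?X J - N K \<inter> ?X (insert K J)) = prob (N K \<inter> ?X J) - prob (N K \<inter> ?X (insert K J))"
      using Suc(2) by (intro finite_measure_Diff) auto
    moreover have "K \<notin> J" "J \<inter> {..<K} = {}" "insert K J \<inter> {..<K} = {}" using Suc(3) by auto
    ultimately show ?case
      using Suc.IH[of J] Suc.IH[of "insert K J"] Suc(2) by (simp add: algebra_simps)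
  qed
  have "{x \<in> space M. \<forall>j\<in>{}. x \<in> F j} = space M" by auto
  then have prob_N: "prob (N K) = (\<Prod>k<K. 1 - prob (F k))" for K
    using main[of "{}" K] sets.sets_into_space[OF N, of K] by (simp add: Int_absorb2)
  have "prob (N K) \<le> (1 - c) ^ K" for K
  proof -
    have "(\<Prod>k<K. 1 - prob (F k)) \<le> (\<Prod>k<K. 1 - c)"
      using c(2) by (intro prod_mono) auto
    then show ?thesis by (simp add: prob_N)
  qed
  moreover have le: "prob {x \<in> space M. \<forall>k. x \<notin> F k} \<le> prob (N K)" for K
    by (intro finite_measure_mono) (auto simp: N_def)
  ultimately have "prob {x \<in> space M. \<forall>k. x \<notin> F k} \<le> (1 - c) ^ K" for K
    using order_trans by blast
  moreover have "(\<lambda>K. (1 - c) ^ K) \<longlonglongrightarrow> 0"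
  proof (rule LIMSEQ_realpow_zero)
    show "0 \<le> 1 - c" using c(2)[of 0] prob_le_1[of "F 0"] by linarith
    show "1 - c < 1" using c(1) by simp
  qed
  ultimately have "prob {x \<in> space M. \<forall>k. x \<notin> F k} \<le> 0"
    by (intro LIMSEQ_le_const[where X = "\<lambda>K. (1 - c) ^ K"]) auto
  then have "prob {x \<in> space M. \<forall>k. x \<notin> F k} = 0" by (simp add: measure_le_0_iff)
  then have "AE x in M. \<not> (\<forall>k. x \<notin> F k)"
    by (subst (asm) prob_eq_0) auto
  then show ?thesis by simp
qed

text \<open>Events that depend on disjoint blocks of coordinates of a product are independent, and
  here each has probability at least \<open>c\<close>.\<close>

lemma (in product_prob_space) AE_ex_block:
  fixes Z :: "nat \<Rightarrow> 'i set"
  assumes fin: "\<And>k. finite (Z k)" and I: "\<And>k. Z k \<subseteq> I" and disj: "disjoint_family Z"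
    and B: "\<And>i. i \<in> I \<Longrightarrow> B i \<in> sets (M i)"
    and c: "c > 0" "\<And>k. (\<Prod>i\<in>Z k. measure (M i) (B i)) \<ge> c"
  shows "AE x in PiM I M. \<exists>k. \<forall>i\<in>Z k. x i \<in> B i"
proof -
  define F where "F k = {x \<in> space (PiM I M). \<forall>i\<in>Z k. x i \<in> B i}" for k
  have pr: "P.prob {x \<in> space (PiM I M). \<forall>i\<in>J. x i \<in> B i} = (\<Prod>i\<in>J. measure (M i) (B i))"
    if "finite J" "J \<subseteq> I" for J
  proof -
    have "emeasure (PiM I M) {x \<in> space (PiM I M). \<forall>i\<in>J. x i \<in> B i} = (\<Prod>i\<in>J. emeasure (M i) (B i))"
      by (rule emeasure_PiM_Collect) (use that B in auto)
    then show ?thesis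
      unfolding P.emeasure_eq_measure M.emeasure_eq_measure
      by (simp add: prod_ennreal prod_nonneg)
  qed
  have "P.indep_events F UNIV"
    unfolding P.indep_events_def
  proof (intro conjI allI impI)
    show "F ` UNIV \<subseteq> P.events"
    proof
      fix X assume "X \<in> F ` UNIV"
      then obtain k where X: "X = {x \<in> space (PiM I M). \<forall>i\<in>Z k. x i \<in> B i}" by (auto simp: F_def)
      show "X \<in> P.events"
        unfolding X using B I[of k]
        by (intro sets.sets_Collect_finite_All fin) (auto intro!: sets_PiM_I_finite sets_Collect_single')
    qed
    fix J :: "nat set" assume J: "J \<subseteq> UNIV" "J \<noteq> {}" "finite J"
    have "(\<Inter>j\<in>J. F j) = {x \<in> space (PiM I M). \<forall>i\<in>(\<Union>j\<in>J. Z j). x i \<in> B i}"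
      using J by (auto simp: F_def)
    also have "P.prob \<dots> = (\<Prod>i\<in>(\<Union>j\<in>J. Z j). measure (M i) (B i))"
      using J fin I by (intro pr) auto
    also have "\<dots> = (\<Prod>j\<in>J. \<Prod>i\<in>Z j. measure (M i) (B i))"
      using J fin disj by (intro prod.UNION_disjoint) (auto simp: disjoint_family_on_def)
    also have "\<dots> = (\<Prod>j\<in>J. P.prob (F j))"
      unfolding F_def by (intro prod.cong refl pr[symmetric] fin I)
    finally show "P.prob (\<Inter>j\<in>J. F j) = (\<Prod>j\<in>J. P.prob (F j))" .
  qed
  then have "AE x in PiM I M. \<exists>k. x \<in> F k"
    using c fin I by (intro P.indep_events_AE_ex[of F c]) (auto simp: F_def pr)
  then show ?thesis by eventually_elim (auto simp: F_def)
qed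

text \<open>The draw at \<open>(i, n)\<close> belongs to the index \<open>i\<close> and the stage
  \<open>n\<close>. The geometric law is chosen as one that gives every natural number positive
  mass.\<close>

definition draws :: "(nat \<times> nat \<Rightarrow> nat) measure" where
  "draws = PiM UNIV (\<lambda>_. measure_pmf (geometric_pmf (1/2)))"

interpretation draws: product_prob_space "\<lambda>_. measure_pmf (geometric_pmf (1/2))" "UNIV :: (nat \<times> nat) set"
  rewrites "PiM UNIV (\<lambda>_. measure_pmf (geometric_pmf (1/2))) \<equiv> draws"
  unfolding draws_def by unfold_locales

lemma space_draws [simp]: "space draws = UNIV"
  by (simp add: draws_def space_PiM)

lemma measurable_draws [measurable]: "(\<lambda>r. r q) \<in> measurable draws (count_space UNIV)"
  using measurable_component_singleton[of q UNIV "\<lambda>_. measure_pmf (geometric_pmf (1/2))"]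
  by (simp add: draws_def)

lemma measurable_draws_comp:
  "(\<lambda>r q. r (f q)) \<in> measurable draws draws"
  using measurable_draws unfolding draws_def
  by (intro measurable_PiM_single') (auto simp: space_PiM)

text \<open>The draws are independent and identically distributed, so reading them through an
  injection of the coordinates keeps the law. The invariance of the final measure comes from
  here.\<close>

lemma distr_draws_reindex:
  assumes "inj f"
  shows "distr draws draws (\<lambda>r q. r (f q)) = draws"
  using distr_PiM_reindex[of UNIV "\<lambda>_. measure_pmf (geometric_pmf (1/2))" f UNIV] assms
  by (simp add: draws_def restrict_def measure_pmf.prob_space_axioms)

text \<open>The bounds \<open>b\<close> on the block size and \<open>m\<close> on the prescribed
  values keep the probability of each block at least \<open>(1 / 2 ^ Suc m) ^ b\<close>.\<close>

lemma AE_draws_block: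
  assumes "\<And>k. finite (Z k)" "disjoint_family (Z :: nat \<Rightarrow> (nat \<times> nat) set)"
    and card: "\<And>k. card (Z k) \<le> b" and w: "\<And>q. w q \<le> m"
  shows "AE r in draws. \<exists>k. \<forall>q\<in>Z k. r q = w q"
proof -
  have "AE r in draws. \<exists>k. \<forall>q\<in>Z k. r q \<in> {w q}"
  proof (rule draws.AE_ex_block[where c = "(1 / 2 ^ Suc m) ^ b"])
    fix k
    have p: "measure (geometric_pmf (1/2)) {v} = 1 / 2 ^ Suc v" for v
      by (simp add: measure_pmf_single power_divide)
    have "(1 / 2 ^ Suc m :: real) ^ b \<le> (1 / 2 ^ Suc m) ^ card (Z k)"
      by (rule power_decreasing[OF card]) (simp_all add: divide_le_eq_1 one_le_power del: power_Suc)
    also have "\<dots> = (\<Prod>q\<in>Z k. 1 / 2 ^ Suc m)" by simp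
    also have "\<dots> \<le> (\<Prod>q\<in>Z k. measure (geometric_pmf (1/2)) {w q})"
      unfolding p using w by (intro prod_mono) (auto simp: frac_le)
    finally show "(1 / 2 ^ Suc m) ^ b \<le> (\<Prod>q\<in>Z k. measure (geometric_pmf (1/2)) {w q})" .
  qed (use assms in auto)
  then show ?thesis by simp
qed

section \<open>Duplication and the tower of finite sets\<close>

text \<open>In the application \<open>col x\<close> is the \<open>U\<close>-predicate containing
  \<open>x\<close>, \<open>V\<close> is the set V_inf, and \<open>H\<close> consists of
  automorphisms of the structure. \<open>move_H\<close> is the form taken by almost-trivial
  definable closure.\<close>

locale movable_group =
  fixes col :: "nat \<Rightarrow> 'c" and V :: "nat set" and H :: "(nat \<Rightarrow> nat) set"
  assumes V_eq: "V = {x. infinite {y. col y = col x}}"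
    and id_H: "id \<in> H"
    and comp_H: "h \<in> H \<Longrightarrow> h' \<in> H \<Longrightarrow> h \<circ> h' \<in> H"
    and inv_H: "h \<in> H \<Longrightarrow> inv h \<in> H"
    and bij_H: "h \<in> H \<Longrightarrow> bij h"
    and col_H: "h \<in> H \<Longrightarrow> col (h x) = col x"
    and fix_H: "h \<in> H \<Longrightarrow> x \<notin> V \<Longrightarrow> h x = x"
    and move_H: "finite F \<Longrightarrow> b \<in> V \<Longrightarrow> b \<notin> F \<Longrightarrow> \<exists>h\<in>H. (\<forall>x\<in>F. h x = x) \<and> h b \<noteq> b"
begin

lemma V_cong: "col x = col y \<Longrightarrow> x \<in> V \<longleftrightarrow> y \<in> V"
  by (simp add: V_eq)

lemma H_in_V: "h \<in> H \<Longrightarrow> h x \<in> V \<longleftrightarrow> x \<in> V"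
  by (rule V_cong) (rule col_H)

lemma H_eq_iff: "h \<in> H \<Longrightarrow> h x = h y \<longleftrightarrow> x = y"
  using bij_H by (meson bij_is_inj injD)

(* The set S of points to be replaced is arbitrary: this is the independence of the duplications. *)
definition duplicates :: "nat set \<Rightarrow> (nat \<Rightarrow> nat) \<Rightarrow> bool" where
  "duplicates A d \<longleftrightarrow> (\<forall>a\<in>A. d a \<noteq> a) \<and>
     (\<forall>S. \<exists>h\<in>H. \<forall>a\<in>A. h a = (if a \<in> S then d a else a))"

text \<open>Induction on the set \<open>T\<close> of points that already have duplicates. A new
  point \<open>t\<close> gets the duplicate \<open>k t\<close>, where \<open>k\<close> fixes the
  other points of \<open>A\<close> and all earlier duplicates; replacing \<open>t\<close> along with
  others means applying \<open>k\<close> last.\<close>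

lemma ex_duplicates:
  assumes "finite A" "A \<subseteq> V"
  shows "\<exists>d. duplicates A d"
proof -
  have "\<exists>d. (\<forall>a\<in>T. d a \<noteq> a) \<and> (\<forall>S\<subseteq>T. \<exists>h\<in>H. \<forall>a\<in>A. h a = (if a \<in> S then d a else a))"
    if "T \<subseteq> A" for T
    using finite_subset[OF that assms(1)] that
  proof (induction T)
    case empty
    show ?case using id_H by (auto intro!: bexI[of _ id])
  next
    case (insert t T)
    then obtain d where d1: "\<forall>a\<in>T. d a \<noteq> a"
      and d2: "\<And>S. S \<subseteq> T \<Longrightarrow> \<exists>h\<in>H. \<forall>a\<in>A. h a = (if a \<in> S then d a else a)"
      by auto
    \<comment> \<open>An element of \<open>H\<close> that fixes \<open>t\<close> sends no other
      point to \<open>t\<close>. So no earlier duplicate equals \<open>t\<close>, and all of them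
      may be put into the finite set fixed by \<open>k\<close>.\<close>
    have nt: "h a \<noteq> t" if "h \<in> H" "h t = t" "a \<noteq> t" for h a
      using H_eq_iff[OF that(1), of a t] that by simp
    have dt: "d a \<noteq> t" if "a \<in> T" for a
    proof -
      obtain h where "h \<in> H" "\<forall>x\<in>A. h x = (if x \<in> {a} then d x else x)"
        using d2[of "{a}"] \<open>a \<in> T\<close> by blast
      moreover have "t \<in> A" "a \<in> A" "a \<noteq> t" using insert that by auto
      ultimately show ?thesis using nt[of h a] by auto
    qed
    have "finite ((A - {t}) \<union> d ` T)" using insert assms(1) by auto
    moreover have "t \<in> V" using insert assms(2) by auto
    moreover have "t \<notin> (A - {t}) \<union> d ` T" using dt by auto
    ultimately obtain k where k: "k \<in> H" "\<forall>x\<in>(A - {t}) \<union> d ` T. k x = x" "k t \<noteq> t"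
      using move_H[of "(A - {t}) \<union> d ` T" t] by blast
    let ?d = "d(t := k t)"
    have "\<exists>h\<in>H. \<forall>a\<in>A. h a = (if a \<in> S then ?d a else a)" if "S \<subseteq> insert t T" for S
    proof -
      have "S - {t} \<subseteq> T" using that by auto
      then obtain h where h: "h \<in> H" "\<And>a. a \<in> A \<Longrightarrow> h a = (if a \<in> S - {t} then d a else a)"
        using d2 by blast
      show ?thesis
      proof (cases "t \<in> S")
        case True
        have "(k \<circ> h) a = (if a \<in> S then ?d a else a)" if "a \<in> A" for a
        proof (cases "a = t")
          case True
          then show ?thesis using h(2)[OF that] \<open>t \<in> S\<close> by simp
        next
          case False
          then show ?thesis using h(2)[OF that] k(2) that \<open>S - {t} \<subseteq> T\<close> by auto
        qed
        then show ?thesis using comp_H[OF k(1) h(1)] by blast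
      next
        case False
        then have "S - {t} = S" by auto
        then show ?thesis using h False by (intro bexI[of _ h]) auto
      qed
    qed
    moreover have "\<forall>a\<in>insert t T. ?d a \<noteq> a" using d1 k(3) by auto
    ultimately show ?case by blast
  qed
  from this[of A] obtain d where d: "\<forall>a\<in>A. d a \<noteq> a"
    "\<And>S. S \<subseteq> A \<Longrightarrow> \<exists>h\<in>H. \<forall>a\<in>A. h a = (if a \<in> S then d a else a)"
    by auto
  have "\<exists>h\<in>H. \<forall>a\<in>A. h a = (if a \<in> S then d a else a)" for S
    using d(2)[of "S \<inter> A"] by auto
  then show ?thesis unfolding duplicates_def using d(1) by blast
qed

text \<open>This is the extension property known from Fraisse limits, with \<open>H\<close>-orbits
  of tuples in the role of isomorphism types.\<close>

definition realizes :: "nat set \<Rightarrow> nat list \<Rightarrow> nat \<Rightarrow> nat set \<Rightarrow> bool" where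
  "realizes C as b B \<longleftrightarrow>
     (\<forall>h\<in>H. h ` set as \<subseteq> C \<longrightarrow> (\<exists>h'\<in>H. map h' as = map h as \<and> h' b \<in> B))"

lemma realizes_mono: "realizes C as b B \<Longrightarrow> B \<subseteq> B' \<Longrightarrow> realizes C as b B'"
  unfolding realizes_def by blast

text \<open>There are finitely many tuples over \<open>C\<close> of the length of \<open>as\<close>,
  and one extension point is enough for each.\<close>

lemma ex_realizes:
  assumes "finite C" "b \<in> V"
  shows "\<exists>B. finite B \<and> B \<subseteq> V \<and> realizes C as b B"
proof -
  define T where "T = {cs. set cs \<subseteq> C \<and> length cs = length as}"
  \<comment> \<open>\<open>w cs\<close> depends on the tuple \<open>cs\<close> and not on the
    \<open>h\<close> that produces it; this makes \<open>B\<close> finite.\<close>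
  define w where "w cs = (SOME h. h \<in> H \<and> map h as = cs) b" for cs
  define B where "B = w ` {cs \<in> T. \<exists>h. h \<in> H \<and> map h as = cs}"
  have "finite T" unfolding T_def by (rule finite_lists_length_eq[OF assms(1)])
  then have "finite B" by (simp add: B_def)
  moreover have "B \<subseteq> V"
  proof
    fix x assume "x \<in> B"
    then obtain cs where x: "x = w cs" and ex: "\<exists>h. h \<in> H \<and> map h as = cs" by (auto simp: B_def)
    show "x \<in> V" unfolding x w_def using someI_ex[OF ex] H_in_V assms(2) by blast
  qed
  moreover have "realizes C as b B"
    unfolding realizes_def
  proof (intro ballI impI)
    fix h assume h: "h \<in> H" "h ` set as \<subseteq> C"
    define h' where "h' = (SOME h'. h' \<in> H \<and> map h' as = map h as)"
    have ex: "\<exists>h'. h' \<in> H \<and> map h' as = map h as" using h by blast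
    have "h' \<in> H \<and> map h' as = map h as" unfolding h'_def by (rule someI_ex[OF ex])
    moreover have "h' b \<in> B"
      unfolding B_def using h ex by (intro image_eqI[of _ _ "map h as"]) (auto simp: w_def h'_def T_def)
    ultimately show "\<exists>h'\<in>H. map h' as = map h as \<and> h' b \<in> B" by blast
  qed
  ultimately show ?thesis by blast
qed

text \<open>Dependent choice, each stage being a finite union. Decoding by \<open>from_nat\<close>
  lets every extension problem \<open>b # as\<close> be met at all sufficiently late stages. The
  problems are posed over \<open>A n\<close> together with its duplicates, because that is where
  walks inside \<open>A n\<close> stand one stage later.\<close>

lemma ex_tower:
  "\<exists>A d. A 0 = {} \<and> (\<forall>n. finite (A n) \<and> A n \<subseteq> V \<and> A n \<subseteq> A (Suc n) \<and>
     duplicates (A n) (d n) \<and> d n ` A n \<subseteq> A (Suc n) \<and> (n \<in> V \<longrightarrow> n \<in> A (Suc n)) \<and>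
     (\<forall>j<n. \<forall>b\<in>V. \<forall>as. from_nat j = b # as \<longrightarrow> realizes (A n \<union> d n ` A n) as b (A (Suc n))))"
proof -
  have step: "\<exists>A'. (finite A' \<and> A' \<subseteq> V) \<and> (\<exists>d. A \<subseteq> A' \<and> duplicates A d \<and> d ` A \<subseteq> A' \<and>
       (n \<in> V \<longrightarrow> n \<in> A') \<and>
       (\<forall>j<n. \<forall>b\<in>V. \<forall>as. from_nat j = b # as \<longrightarrow> realizes (A \<union> d ` A) as b A'))"
    if A: "finite A" "A \<subseteq> V" for A n
  proof -
    obtain d where d: "duplicates A d" using ex_duplicates A by blast
    let ?C = "A \<union> d ` A"
    have dV: "d ` A \<subseteq> V"
    proof
      fix x assume "x \<in> d ` A"
      then obtain a where a: "a \<in> A" "x = d a" by blast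
      obtain h where "h \<in> H" "\<forall>a\<in>A. h a = (if a \<in> UNIV then d a else a)"
        using d unfolding duplicates_def by blast
      then show "x \<in> V" using a A H_in_V[of h a] by auto
    qed
    have "\<exists>B. finite B \<and> B \<subseteq> V \<and>
      (\<forall>b\<in>V. \<forall>as. from_nat j = b # as \<longrightarrow> realizes ?C as b B)" for j
    proof (cases "\<exists>b as. b \<in> V \<and> from_nat j = b # as")
      case True
      then obtain b as where j: "from_nat j = b # as" "b \<in> V" by blast
      obtain B where "finite B" "B \<subseteq> V" "realizes ?C as b B"
        using ex_realizes[of ?C b as] A j by auto
      then show ?thesis using j by auto
    qed auto
    then obtain B where B: "\<And>j. finite (B j)" "\<And>j. B j \<subseteq> V"
      "\<And>j b as. b \<in> V \<Longrightarrow> from_nat j = b # as \<Longrightarrow> realizes ?C as b (B j)"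
      by metis
    let ?A = "?C \<union> (\<Union>j<n. B j) \<union> ({n} \<inter> V)"
    have "finite ?A" "?A \<subseteq> V" using A B dV by auto
    moreover have "realizes ?C as b ?A" if "j < n" "b \<in> V" "from_nat j = b # as" for j b as
      by (rule realizes_mono[OF B(3)[OF that(2,3)]]) (use that in auto)
    ultimately show ?thesis using d by (intro exI[of _ ?A] conjI exI[of _ d]) auto
  qed
  have "\<exists>A. \<forall>n. (finite (A n) \<and> A n \<subseteq> V \<and> (n = 0 \<longrightarrow> A n = {})) \<and>
     (\<exists>d. A n \<subseteq> A (Suc n) \<and> duplicates (A n) d \<and> d ` A n \<subseteq> A (Suc n) \<and>
       (n \<in> V \<longrightarrow> n \<in> A (Suc n)) \<and>
       (\<forall>j<n. \<forall>b\<in>V. \<forall>as. from_nat j = b # as \<longrightarrow> realizes (A n \<union> d ` A n) as b (A (Suc n))))"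
    by (rule dependent_nat_choice) (use step in auto)
  then show ?thesis by metis
qed

end

section \<open>Random walks through the tower\<close>

locale movable_tower = movable_group col V H
  for col :: "nat \<Rightarrow> 'c" and V H +
  fixes A :: "nat \<Rightarrow> nat set" and d :: "nat \<Rightarrow> nat \<Rightarrow> nat"
  assumes A_0: "A 0 = {}"
    and finite_A: "finite (A n)"
    and A_V: "A n \<subseteq> V"
    and A_Suc: "A n \<subseteq> A (Suc n)"
    and dup: "duplicates (A n) (d n)"
    and d_A: "d n ` A n \<subseteq> A (Suc n)"
    and V_A: "n \<in> V \<Longrightarrow> n \<in> A (Suc n)"
    and realizes_A: "j < n \<Longrightarrow> b \<in> V \<Longrightarrow> from_nat j = b # as \<Longrightarrow>
      realizes (A n \<union> d n ` A n) as b (A (Suc n))"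
begin

(* st r i n is the position of the walk of the index i at stage n; it is constant on draws outside
   the class of i while the walk has not entered the tower. *)
primrec st :: "(nat \<times> nat \<Rightarrow> nat) \<Rightarrow> nat \<Rightarrow> nat \<Rightarrow> nat" where
  "st r i 0 = (LEAST y. col y = col i)"
| "st r i (Suc n) =
    (if st r i n \<in> A n then (if r (i, n) = 0 then d n (st r i n) else st r i n)
     else if col (r (i, n)) = col i then r (i, n) else st r i n)"

(* The first column of draws that happens to permute the class of i. The choice commutes with
   relabelling the class, which makes the resulting random permutation uniform; if no such column
   exists, the value is meaningless. *)
definition tau :: "(nat \<times> nat \<Rightarrow> nat) \<Rightarrow> nat \<Rightarrow> nat" where
  "tau r i = r (i, LEAST n. bij_betw (\<lambda>y. r (y, n)) {y. col y = col i} {y. col y = col i})"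

definition pos :: "(nat \<times> nat \<Rightarrow> nat) \<Rightarrow> nat \<Rightarrow> nat \<Rightarrow> nat" where
  "pos r n i = (if i \<in> V then st r i n else tau r i)"

text \<open>The first clause lets any finite set of indices make prescribed draws at a common late
  stage; it makes walks enter the tower and separate, and makes \<open>tau\<close> a permutation of
  each finite class. The second clause provides indices with a prescribed initial history, for the
  surjectivity in the back-and-forth.\<close>

definition generic :: "(nat \<times> nat \<Rightarrow> nat) \<Rightarrow> bool" where
  "generic r \<longleftrightarrow>
     (\<forall>w::nat list. \<forall>m. \<exists>n\<ge>m. \<forall>i<length w. r (i, n) = w ! i) \<and>
     (\<forall>w::nat list. \<forall>x\<in>V. \<forall>m. \<exists>i\<ge>m. col i = col x \<and> (\<forall>n<length w. r (i, n) = w ! n))"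

lemma mono_A: "m \<le> n \<Longrightarrow> A m \<subseteq> A n"
  by (rule lift_Suc_mono_le[of A]) (rule A_Suc)

lemma d_move: "a \<in> A n \<Longrightarrow> \<exists>h\<in>H. h a = d n a"
  using dup[of n] unfolding duplicates_def by (metis UNIV_I)

lemma col_st: "col (st r i n) = col i"
proof (induction n)
  case 0
  show ?case by (simp, rule LeastI[of "\<lambda>y. col y = col i" i]) simp
next
  case (Suc n)
  have "col (d n (st r i n)) = col i" if "st r i n \<in> A n"
    using d_move[OF that] col_H Suc by metis
  then show ?case using Suc by simp
qed

lemma st_A_Suc: "st r i n \<in> A n \<Longrightarrow> st r i (Suc n) \<in> A n \<union> d n ` A n"
  by simp

lemma st_A_mono:
  assumes "st r i n \<in> A n" "n \<le> m"
  shows "st r i m \<in> A m"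
  using assms(2)
proof (induction m rule: dec_induct)
  case (step m)
  then show ?case using st_A_Suc[of r i m] A_Suc[of m] d_A[of m] by blast
qed (rule assms(1))

text \<open>The coins of one stage select a set \<open>S\<close> of positions to be replaced by
  duplicates, and independence of the duplications turns this into a single element of
  \<open>H\<close>. The passage over several stages is a composition.\<close>

lemma st_transport:
  assumes I: "\<And>i. i \<in> I \<Longrightarrow> st r i n \<in> A n" "inj_on (\<lambda>i. st r i n) I" and "n \<le> m"
  shows "\<exists>h\<in>H. \<forall>i\<in>I. st r i m = h (st r i n)"
  using \<open>n \<le> m\<close>
proof (induction m rule: dec_induct)
  case base
  show ?case using id_H by (intro bexI[of _ id]) auto
next
  case (step m)
  then obtain h where h: "h \<in> H" "\<And>i. i \<in> I \<Longrightarrow> st r i m = h (st r i n)" by blast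
  have inj: "i = j" if "i \<in> I" "j \<in> I" "st r i m = st r j m" for i j
    using that h I(2) H_eq_iff by (auto dest: inj_onD)
  \<comment> \<open>Since the positions are distinct, membership in \<open>S\<close> of the position
    of \<open>i\<close> reveals the coin of \<open>i\<close>.\<close>
  define S where "S = {st r i m | i. i \<in> I \<and> r (i, m) = 0}"
  obtain k where k: "k \<in> H" "\<And>a. a \<in> A m \<Longrightarrow> k a = (if a \<in> S then d m a else a)"
    using dup[of m] unfolding duplicates_def by metis
  have "st r i (Suc m) = (k \<circ> h) (st r i n)" if "i \<in> I" for i
  proof -
    have m: "st r i m \<in> A m" using I(1)[OF that] step(1) st_A_mono by auto
    have "st r i m \<in> S \<longleftrightarrow> r (i, m) = 0"
      using inj that unfolding S_def by auto
    then show ?thesis using k(2)[OF m] h(2)[OF that, symmetric] m by simp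
  qed
  then show ?case using comp_H[OF k(1) h(1)] by blast
qed

lemma generic_pattern:
  assumes "generic r" "finite I"
  shows "\<exists>n\<ge>m. \<forall>i\<in>I. r (i, n) = w i"
proof -
  obtain N where N: "I \<subseteq> {..<N}" using finite_nat_bounded[OF assms(2)] by blast
  obtain n where "n \<ge> m" "\<forall>i<length (map w [0..<N]). r (i, n) = map w [0..<N] ! i"
    using assms(1) unfolding generic_def by blast
  then show ?thesis using N by (intro exI[of _ n]) auto
qed

text \<open>The point \<open>i\<close> lies in \<open>A n\<close> from some stage on. At a late
  stage where \<open>i\<close> draws itself, its walk is inside already or is thrown to
  \<open>i\<close>.\<close>

lemma generic_enters:
  assumes "generic r" "i \<in> V"
  shows "\<forall>\<^sub>F n in sequentially. st r i n \<in> A n"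
proof -
  obtain n where n: "n \<ge> Suc i" "\<forall>i\<in>{i}. r (i, n) = i" 
    using generic_pattern[OF assms(1), where I = "{i}" and m = "Suc i" and w = "\<lambda>_. i"] by auto
  have "i \<in> A n" using V_A[OF assms(2)] mono_A[OF n(1)] by blast
  then have "st r i (Suc n) \<in> A (Suc n)"
    using n st_A_mono[of r i n "Suc n"] A_Suc[of n] by (cases "st r i n \<in> A n") auto
  from st_A_mono[OF this] show ?thesis by (rule eventually_sequentiallyI)
qed

text \<open>If both walks share a position in the tower, a stage at which \<open>i\<close> draws 0
  and \<open>j\<close> draws 1 sends just one of them to the duplicate. Once apart they stay apart,
  as later positions are images under one injective \<open>h\<close>.\<close>

lemma generic_separates:
  assumes "generic r" "i \<in> V" "j \<in> V" "i \<noteq> j"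
  shows "\<forall>\<^sub>F n in sequentially. st r i n \<noteq> st r j n"
proof -
  obtain N where N: "\<And>n. n \<ge> N \<Longrightarrow> st r i n \<in> A n" "\<And>n. n \<ge> N \<Longrightarrow> st r j n \<in> A n"
    using eventually_conj[OF generic_enters[OF assms(1,2)] generic_enters[OF assms(1,3)]]
    unfolding eventually_sequentially by blast
  obtain n where n: "n \<ge> N" "\<forall>k\<in>{i, j}. r (k, n) = (if k = i then 0 else 1)"
    using generic_pattern[OF assms(1), of "{i,j}" N "\<lambda>k. if k = i then 0 else 1"] by auto
  have "\<exists>n\<ge>N. st r i n \<noteq> st r j n"
  proof (cases "st r i n = st r j n")
    case True
    have "d n (st r j n) \<noteq> st r j n" using dup[of n] N(2)[OF n(1)] by (auto simp: duplicates_def)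
    then have "st r i (Suc n) \<noteq> st r j (Suc n)" using True N[OF n(1)] n(2) assms(4) by auto
    then show ?thesis using n(1) le_Suc_eq by blast
  qed (use n in blast)
  then obtain n where n: "n \<ge> N" "st r i n \<noteq> st r j n" by blast
  have "st r i m \<noteq> st r j m" if "m \<ge> n" for m
  proof -
    have "\<exists>h\<in>H. \<forall>k\<in>{i,j}. st r k m = h (st r k n)"
      by (rule st_transport[OF _ _ that]) (use N n in auto)
    then show ?thesis using n(2) H_eq_iff by auto
  qed
  then show ?thesis by (rule eventually_sequentiallyI)
qed

lemma generic_settled:
  assumes "generic r" "finite I" "I \<subseteq> V"
  shows "\<forall>\<^sub>F n in sequentially. (\<forall>i\<in>I. st r i n \<in> A n) \<and> inj_on (\<lambda>i. st r i n) I"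
proof -
  have "\<forall>\<^sub>F n in sequentially. \<forall>i\<in>I. st r i n \<in> A n"
    using assms generic_enters by (intro eventually_ball_finite) auto
  moreover have "\<forall>\<^sub>F n in sequentially. \<forall>i\<in>I. \<forall>j\<in>I. i \<noteq> j \<longrightarrow> st r i n \<noteq> st r j n"
    using assms generic_separates by (intro eventually_ball_finite ballI) (auto simp: subset_iff)
  ultimately show ?thesis by eventually_elim (auto simp: inj_on_def)
qed

section \<open>Back-and-forth between indices and points\<close>

text \<open>A pair \<open>(i, a)\<close> relates an index to a point of the structure, and
  \<open>p\<close> is a finite stage of the back-and-forth: the positions of its indices eventually
  form an \<open>H\<close>-copy of its points, with an \<open>h\<close> that may change with
  \<open>n\<close>.\<close>

definition matched :: "(nat \<times> nat \<Rightarrow> nat) \<Rightarrow> (nat \<times> nat) set \<Rightarrow> bool" where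
  "matched r p \<longleftrightarrow> finite p \<and> p \<subseteq> V \<times> V \<and>
     (\<forall>\<^sub>F n in sequentially. \<exists>h\<in>H. \<forall>(i, a)\<in>p. h a = st r i n)"

text \<open>At a settled stage \<open>n\<close> the position of \<open>i\<close> is pulled back by
  the \<open>h\<close> that serves \<open>p\<close>; \<open>st_transport\<close> carries the match
  to all later stages.\<close>

lemma matched_insert_left:
  assumes r: "generic r" and p: "matched r p" and i: "i \<in> V"
  shows "\<exists>a. matched r (insert (i, a) p)"
proof -
  let ?I = "insert i (fst ` p)"
  have "finite ?I" "?I \<subseteq> V" using p i by (auto simp: matched_def)
  from eventually_conj[OF generic_settled[OF r this] p[unfolded matched_def, THEN conjunct2, THEN conjunct2]]
  obtain n where n: "\<forall>i\<in>?I. st r i n \<in> A n" "inj_on (\<lambda>i. st r i n) ?I"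
    and "\<exists>h\<in>H. \<forall>(i, a)\<in>p. h a = st r i n"
    unfolding eventually_sequentially by blast
  then obtain h where h: "h \<in> H" "\<And>i a. (i, a) \<in> p \<Longrightarrow> h a = st r i n" by blast
  define a where "a = inv h (st r i n)"
  have ha: "h a = st r i n" using bij_H[OF h(1)] by (simp add: a_def bij_is_surj surj_f_inv_f)
  have "\<exists>h\<in>H. \<forall>(j, a)\<in>insert (i, a) p. h a = st r j m" if "m \<ge> n" for m
  proof -
    have "\<exists>k\<in>H. \<forall>i\<in>?I. st r i m = k (st r i n)"
      by (rule st_transport[OF _ n(2) that]) (use n in auto)
    then obtain k where k: "k \<in> H" "\<And>i. i \<in> ?I \<Longrightarrow> st r i m = k (st r i n)" by blast
    have "(k \<circ> h) c = st r j m" if "(j, c) \<in> insert (i, a) p" for j c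
      using that h(2) ha k(2)[of j] by force
    then show ?thesis using comp_H[OF k(1) h(1)] by blast
  qed
  moreover have "a \<in> V" using H_in_V[OF h(1), of a] ha V_cong[OF col_st] i by simp
  ultimately show ?thesis using p i unfolding matched_def eventually_sequentially by blast
qed

text \<open>The index draws \<open>n\<close> times a point \<open>z\<close> of its class outside
  \<open>A n\<close>, so that it waits at \<open>z\<close>, and draws \<open>d'\<close>
  next.\<close>

lemma generic_fresh:
  assumes "generic r" "x \<in> V" "d' \<in> V" "col d' = col x" "n > 0"
  shows "\<exists>i\<ge>m. col i = col x \<and> st r i n \<notin> A n \<and> r (i, n) = d'"
proof -
  have "infinite {y. col y = col x}" using assms(2) by (simp add: V_eq)
  then have "\<not> {y. col y = col x} \<subseteq> A n" using finite_A[of n] finite_subset by auto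
  then obtain z where z: "col z = col x" "z \<notin> A n" by blast
  obtain i where i: "i \<ge> m" "col i = col x"
    "\<forall>k<length (replicate n z @ [d']). r (i, k) = (replicate n z @ [d']) ! k"
    using assms(1,2) unfolding generic_def by blast
  have r: "r (i, k) = z" if "k < n" for k using i(3) that by (auto simp: nth_append)
  have rn: "r (i, n) = d'" using i(3)[rule_format, of n] by (simp add: nth_append)
  have "st r i (Suc k) = z" if "k < n" for k
    using that
  proof (induction k)
    case 0
    \<comment> \<open>\<open>A 0\<close> is empty, so the first draw takes effect whatever the
      starting position.\<close>
    then show ?case using r[of 0] z i(2) A_0 by simp
  next
    case (Suc k)
    then have "st r i (Suc k) = z" by simp
    moreover have "z \<notin> A (Suc k)" using z(2) mono_A[of "Suc k" n] Suc by auto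
    ultimately show ?case using r[of "Suc k"] z i(2) Suc.prems by simp
  qed
  from this[of "n - 1"] have "st r i n = z" using assms(5) by simp
  then show ?thesis using i(1,2) rn z(2) by blast
qed

text \<open>The tower contains a point \<open>h' b\<close> that completes the positions of
  \<open>p\<close> to a copy including \<open>b\<close>. A fresh index of the class of
  \<open>b\<close>, still outside the tower at stage \<open>n\<close>, is thrown exactly
  there.\<close>

lemma matched_insert_right:
  assumes r: "generic r" and p: "matched r p" and b: "b \<in> V"
  shows "\<exists>i. matched r (insert (i, b) p)"
proof (cases "b \<in> snd ` p")
  case True
  then obtain i where "(i, b) \<in> p" by auto
  then have "insert (i, b) p = p" by auto
  then show ?thesis using p by metis
next
  case False
  let ?I = "fst ` p"
  have fin: "finite p" and "finite ?I" "?I \<subseteq> V" using p by (auto simp: matched_def)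
  obtain as where as: "set as = snd ` p" using fin by (metis finite_imageI finite_list)
  from eventually_conj[OF generic_settled[OF r \<open>finite ?I\<close> \<open>?I \<subseteq> V\<close>]
      p[unfolded matched_def, THEN conjunct2, THEN conjunct2]]
  obtain N where N: "\<And>n. n \<ge> N \<Longrightarrow> (\<forall>i\<in>?I. st r i n \<in> A n) \<and> inj_on (\<lambda>i. st r i n) ?I \<and>
      (\<exists>h\<in>H. \<forall>(i, a)\<in>p. h a = st r i n)"
    unfolding eventually_sequentially by auto
  \<comment> \<open>From \<open>N\<close> on the walks of \<open>p\<close> are settled, and beyond
    the code of \<open>b # as\<close> the tower answers this extension problem.\<close>
  define n where "n = Suc (max N (to_nat (b # as)))"
  have n: "n \<ge> N" "Suc n \<ge> N" "to_nat (b # as) < n" "n > 0" by (auto simp: n_def)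
  obtain h where h: "h \<in> H" "\<And>i a. (i, a) \<in> p \<Longrightarrow> h a = st r i (Suc n)"
    using N[OF n(2)] by blast
  \<comment> \<open>The walks of \<open>p\<close> are in \<open>A n\<close> at stage
    \<open>n\<close>, so one step leaves them among these points and their duplicates, the set over
    which \<open>realizes_A\<close> applies.\<close>
  have "h ` set as \<subseteq> A n \<union> d n ` A n"
  proof
    fix x assume "x \<in> h ` set as"
    then obtain i a where "(i, a) \<in> p" "x = h a" by (auto simp: as)
    then show "x \<in> A n \<union> d n ` A n" using h(2) N[OF n(1)] st_A_Suc[of r i n] by force
  qed
  then obtain h' where h': "h' \<in> H" "map h' as = map h as" "h' b \<in> A (Suc n)"
    using realizes_A[OF n(3) b, of as] h(1) unfolding realizes_def by auto
  have h'_p: "h' a = st r i (Suc n)" if "(i, a) \<in> p" for i a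
  proof -
    have "a \<in> set as" using that by (force simp: as)
    then show ?thesis using h'(2) h(2)[OF that] by simp
  qed
  have "h' b \<in> V" using h'(3) A_V by blast
  obtain i where i: "i \<ge> Suc (Max (insert 0 ?I))" "col i = col b" "st r i n \<notin> A n" "r (i, n) = h' b"
    using generic_fresh[OF r b \<open>h' b \<in> V\<close> col_H[OF h'(1)] n(4)] by blast
  have sti: "st r i (Suc n) = h' b" using i col_H[OF h'(1)] by simp
  let ?J = "insert i ?I"
  have inj: "inj_on (\<lambda>i. st r i (Suc n)) ?J"
  proof (subst inj_on_insert, intro conjI)
    show "inj_on (\<lambda>i. st r i (Suc n)) ?I" using N[OF n(2)] by blast
    have "st r i (Suc n) \<noteq> st r j (Suc n)" if "(j, a) \<in> p" for j a
    proof -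
      have "b \<noteq> a" using that False by force
      then show ?thesis using H_eq_iff[OF h'(1), of b a] h'_p[OF that] sti by simp
    qed
    then show "st r i (Suc n) \<notin> (\<lambda>i. st r i (Suc n)) ` (?I - {i})" by force
  qed
  have "\<exists>h\<in>H. \<forall>(j, a)\<in>insert (i, b) p. h a = st r j m" if "m \<ge> Suc n" for m
  proof -
    have "\<exists>k\<in>H. \<forall>i\<in>?J. st r i m = k (st r i (Suc n))"
    proof (rule st_transport[OF _ inj that])
      fix j assume "j \<in> ?J"
      then show "st r j (Suc n) \<in> A (Suc n)" using N[OF n(2)] sti h'(3) by (metis insert_iff)
    qed
    then obtain k where k: "k \<in> H" "\<And>i. i \<in> ?J \<Longrightarrow> st r i m = k (st r i (Suc n))" by blast
    have "(k \<circ> h') c = st r j m" if "(j, c) \<in> insert (i, b) p" for j c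
    proof -
      have "j \<in> ?J" using that by force
      moreover have "h' c = st r j (Suc n)" using that h'_p sti by (auto simp del: st.simps)
      ultimately show ?thesis using k(2)[of j] by simp
    qed
    then show ?thesis using comp_H[OF k(1) h'(1)] by blast
  qed
  moreover have "i \<in> V" using V_cong[OF i(2)] b by simp
  ultimately show ?thesis using p b unfolding matched_def eventually_sequentially by blast
qed

lemma matched_mono: "matched r p \<Longrightarrow> q \<subseteq> p \<Longrightarrow> matched r q"
  unfolding matched_def by (auto intro: finite_subset elim!: eventually_mono) blast

text \<open>One direction is injectivity of the elements of \<open>H\<close>, the other is
  separation of walks.\<close>

lemma matched_iff:
  assumes r: "generic r" and p: "matched r p" and ij: "(i, a) \<in> p" "(j, b) \<in> p"
  shows "i = j \<longleftrightarrow> a = b"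
proof -
  have V: "i \<in> V" "j \<in> V" using p ij by (auto simp: matched_def)
  have p': "\<forall>\<^sub>F n in sequentially. \<exists>h\<in>H. h a = st r i n \<and> h b = st r j n"
    using p ij unfolding matched_def by (auto elim!: eventually_mono)
  show ?thesis
  proof
    assume "i = j"
    obtain n h where "h \<in> H" "h a = st r i n" "h b = st r j n"
      using eventually_happens[OF p'] by auto
    then show "a = b" using H_eq_iff[of h a b] \<open>i = j\<close> by simp
  next
    assume "a = b"
    show "i = j"
    proof (rule ccontr)
      assume "i \<noteq> j"
      from eventually_conj[OF generic_separates[OF r V this] p'] \<open>a = b\<close>
      show False using eventually_happens by fastforce
    qed
  qed
qed

lemma matched_col:
  assumes "matched r p" "(i, a) \<in> p"
  shows "col a = col i"
proof -
  have "\<forall>\<^sub>F n in sequentially. \<exists>h\<in>H. h a = st r i n"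
    using assms unfolding matched_def by (auto elim!: eventually_mono)
  then obtain n h where "h \<in> H" "h a = st r i n" by (auto dest!: eventually_happens)
  then show ?thesis using col_H[of h a] col_st by simp
qed

text \<open>Genericity gives a stage whose draws form the identity on the finite class, so a least
  column that permutes the class exists. It is the same for all members of the class.\<close>

lemma tau_bij_betw:
  assumes "generic r" "i \<notin> V"
  shows "bij_betw (tau r) {y. col y = col i} {y. col y = col i}"
proof -
  define C where "C = {y. col y = col i}"
  have "finite C" using assms(2) by (simp add: C_def V_eq)
  then obtain n where "\<forall>y\<in>C. r (y, n) = y" using generic_pattern[OF assms(1), of C 0 "\<lambda>y. y"] by blast
  then have "bij_betw (\<lambda>y. r (y, n)) C C" by (auto simp: bij_betw_def inj_on_def)
  then have "bij_betw (\<lambda>y. r (y, LEAST n. bij_betw (\<lambda>y. r (y, n)) C C)) C C" by (rule LeastI)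
  moreover have "tau r y = r (y, LEAST n. bij_betw (\<lambda>y. r (y, n)) C C)" if "y \<in> C" for y
    using that by (simp add: tau_def C_def)
  ultimately show ?thesis unfolding C_def[symmetric] by (simp cong: bij_betw_cong)
qed

text \<open>The union of a chain of matched sets is the graph of a bijection of \<open>V\<close>,
  completed by \<open>tau\<close> outside \<open>V\<close>. Elements of \<open>H\<close> fix the
  points outside \<open>V\<close>, so the \<open>h\<close> found for the indices of \<open>I\<close>
  in \<open>V\<close> serves all of \<open>I\<close>.\<close>

lemma ex_limit_bij:
  assumes r: "generic r"
  shows "\<exists>f. bij f \<and> (\<forall>x. col (f x) = col x) \<and>
    (\<forall>I. finite I \<longrightarrow> (\<forall>\<^sub>F n in sequentially. \<exists>h\<in>H. \<forall>i\<in>I. pos r n i = h (f i)))"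
proof -
  have "\<exists>p. \<forall>n. matched r (p n) \<and>
      (p n \<subseteq> p (Suc n) \<and> (n \<in> V \<longrightarrow> n \<in> fst ` p (Suc n) \<and> n \<in> snd ` p (Suc n)))"
  proof (rule dependent_nat_choice)
    show "\<exists>p. matched r p" using id_H by (intro exI[of _ "{}"]) (auto simp: matched_def)
    fix p n assume p: "matched r p"
    show "\<exists>q. matched r q \<and> (p \<subseteq> q \<and> (n \<in> V \<longrightarrow> n \<in> fst ` q \<and> n \<in> snd ` q))"
    proof (cases "n \<in> V")
      case True
      obtain a where a: "matched r (insert (n, a) p)" using matched_insert_left[OF r p True] by blast
      obtain i where "matched r (insert (i, n) (insert (n, a) p))"
        using matched_insert_right[OF r a True] by blast
      then show ?thesis by (intro exI[of _ "insert (i, n) (insert (n, a) p)"]) auto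
    qed (use p in auto)
  qed
  then obtain p where p: "\<And>n. matched r (p n)" "\<And>n. p n \<subseteq> p (Suc n)"
    and total: "\<And>n. n \<in> V \<Longrightarrow> n \<in> fst ` p (Suc n)" "\<And>n. n \<in> V \<Longrightarrow> n \<in> snd ` p (Suc n)" by blast
  define R where "R = (\<Union>n. p n)"
  have mono: "p m \<subseteq> p n" if "m \<le> n" for m n
    by (rule lift_Suc_mono_le[of p]) (use p(2) that in auto)
  have matched_R: "matched r q" if "finite q" "q \<subseteq> R" for q
  proof -
    have "\<exists>n. q \<subseteq> p n"
      using that
    proof (induction q)
      case (insert x q)
      then obtain m n where "q \<subseteq> p m" "x \<in> p n" by (auto simp: R_def)
      then have "insert x q \<subseteq> p (max m n)" using mono[of m "max m n"] mono[of n "max m n"] by auto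
      then show ?case by blast
    qed auto
    then show ?thesis using p(1) matched_mono by blast
  qed
  have R_iff: "i = j \<longleftrightarrow> a = b" if "(i, a) \<in> R" "(j, b) \<in> R" for i j a b
    by (rule matched_iff[OF r matched_R[of "{(i, a), (j, b)}"]]) (use that in auto)
  have R_col: "col a = col i" if "(i, a) \<in> R" for i a
    by (rule matched_col[OF matched_R[of "{(i, a)}"]]) (use that in auto)
  have R_left: "\<exists>a. (i, a) \<in> R" if "i \<in> V" for i using total(1)[OF that] by (force simp: R_def)
  have R_right: "\<exists>i. (i, a) \<in> R" if "a \<in> V" for a using total(2)[OF that] by (force simp: R_def)
  define f where "f x = (if x \<in> V then THE a. (x, a) \<in> R else tau r x)" for x
  have fR: "f i = a" if "(i, a) \<in> R" for i a
  proof -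
    have "i \<in> V" using matched_R[of "{(i, a)}"] that by (simp add: matched_def)
    then show ?thesis using that R_iff unfolding f_def by (auto intro!: the_equality)
  qed
  have Rf: "(i, f i) \<in> R" if "i \<in> V" for i using R_left[OF that] fR by blast
  have f_tau: "f x = tau r x" if "x \<notin> V" for x using that by (simp add: f_def)
  have f_col: "col (f x) = col x" for x
  proof (cases "x \<in> V")
    case False
    then show ?thesis using bij_betwE[OF tau_bij_betw[OF r False]] f_tau[OF False] by auto
  qed (use Rf R_col in blast)
  have "inj f"
  proof (rule injI)
    fix x y assume xy: "f x = f y"
    then have c: "col x = col y" using f_col by metis
    show "x = y"
    proof (cases "x \<in> V")
      case True
      then show ?thesis using c V_cong Rf R_iff xy by metis
    next
      case False
      then have "tau r x = tau r y" using xy f_tau V_cong[OF c] by simp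
      then show ?thesis
        using bij_betw_imp_inj_on[OF tau_bij_betw[OF r False]] c by (auto dest: inj_onD)
    qed
  qed
  moreover have "surj f"
  proof -
    have "\<exists>x. f x = y" for y
    proof (cases "y \<in> V")
      case False
      have "y \<in> tau r ` {x. col x = col y}"
        using bij_betw_imp_surj_on[OF tau_bij_betw[OF r False]] by simp
      then obtain x where "col x = col y" "tau r x = y" by auto
      then show ?thesis using f_tau V_cong False by metis
    qed (use R_right fR in blast)
    then show ?thesis by (metis surjI)
  qed
  moreover have "\<forall>\<^sub>F n in sequentially. \<exists>h\<in>H. \<forall>i\<in>I. pos r n i = h (f i)" if "finite I" for I
  proof -
    have "matched r ((\<lambda>i. (i, f i)) ` (I \<inter> V))" using that Rf by (intro matched_R) auto
    then have "\<forall>\<^sub>F n in sequentially. \<exists>h\<in>H. \<forall>i\<in>I \<inter> V. h (f i) = st r i n"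
      by (auto simp: matched_def)
    then show ?thesis
    proof eventually_elim
      case (elim n)
      then obtain h where h: "h \<in> H" "\<And>i. i \<in> I \<Longrightarrow> i \<in> V \<Longrightarrow> h (f i) = st r i n" by blast
      have "pos r n i = h (f i)" if "i \<in> I" for i
      proof (cases "i \<in> V")
        case False
        then have "h (f i) = f i" by (intro fix_H[OF h(1)]) (simp add: V_cong[OF f_col])
        then show ?thesis using False by (simp add: pos_def f_tau)
      qed (use that h in \<open>simp add: pos_def\<close>)
      then show ?case using h(1) by blast
    qed
  qed
  ultimately show ?thesis using f_col by (auto simp: bij_def)
qed

text \<open>The walk of an index uses its own draws and its class alone. For \<open>tau\<close>,
  precomposing with \<open>g\<close> permutes the class and does not affect which columns are
  bijective on it.\<close>

lemma pos_reindex: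
  assumes g: "bij g" "\<And>x. col (g x) = col x"
  shows "pos (\<lambda>(i, n). r (g i, n)) n i = pos r n (g i)"
proof -
  have st: "st (\<lambda>(i, n). r (g i, n)) i n = st r (g i) n" for n
    by (induction n) (simp_all add: g)
  let ?C = "{y. col y = col i}"
  have "bij_betw g ?C ?C"
    unfolding bij_betw_def
  proof
    show "g ` ?C = ?C"
    proof (intro equalityI subsetI)
      fix y assume "y \<in> ?C"
      moreover obtain x where "y = g x" using g(1) by (metis bij_pointE)
      ultimately show "y \<in> g ` ?C" using g(2) by auto
    qed (use g(2) in auto)
  qed (use g(1) in \<open>auto simp: bij_def intro: inj_on_subset\<close>)
  then have "bij_betw (\<lambda>y. r (g y, n)) ?C ?C \<longleftrightarrow> bij_betw (\<lambda>y. r (y, n)) ?C ?C" for n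
    using bij_betw_comp_iff[of g ?C ?C "\<lambda>y. r (y, n)" ?C] by (simp add: comp_def)
  then have "tau (\<lambda>(i, n). r (g i, n)) i = tau r (g i)"
    by (simp add: tau_def g(2))
  then show ?thesis using V_cong[OF g(2)] st by (simp add: pos_def)
qed

section \<open>Measurability and almost sure genericity\<close>

lemma measurable_st [measurable]: "(\<lambda>r. st r i n) \<in> measurable draws (count_space UNIV)"
proof (induction n)
  case (Suc n)
  note Suc [measurable]
  have [measurable]: "(\<lambda>r. d n (st r i n)) \<in> measurable draws (count_space UNIV)"
    by (rule measurable_compose[OF Suc]) simp
  show ?case by simp
qed simp

lemma measurable_tau:
  assumes "i \<notin> V"
  shows "(\<lambda>r. tau r i) \<in> measurable draws (count_space UNIV)"
proof -
  define C where "C = {y. col y = col i}"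
  have "finite C" using assms by (simp add: C_def V_eq)
  have "Measurable.pred draws (\<lambda>r. bij_betw (\<lambda>y. r (y, n)) C C)" for n
  proof -
    \<comment> \<open>On a finite set an injective self-map is onto, which leaves a finite condition
      on the draws.\<close>
    have "bij_betw (\<lambda>y. r (y, n)) C C \<longleftrightarrow>
       (\<forall>x\<in>C. \<forall>y\<in>C. r (x, n) = r (y, n) \<longrightarrow> x = y) \<and> (\<forall>x\<in>C. r (x, n) \<in> C)" for r :: "nat \<times> nat \<Rightarrow> nat"
      using \<open>finite C\<close> endo_inj_surj[of C "\<lambda>y. r (y, n)"]
      by (auto simp: bij_betw_def inj_on_def)
    then show ?thesis by simp
  qed
  then have [measurable]: "(\<lambda>r. LEAST n. bij_betw (\<lambda>y. r (y, n)) C C) \<in> measurable draws (count_space UNIV)"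
    by measurable
  show ?thesis
    unfolding tau_def C_def[symmetric]
    by (rule measurable_compose_countable[where f = "\<lambda>n r. r (i, n)"]) measurable
qed

lemma measurable_pos [measurable]: "(\<lambda>r. pos r n i) \<in> measurable draws (count_space UNIV)"
  by (cases "i \<in> V") (simp_all add: pos_def measurable_tau)

lemma measurable_map_pos [measurable]:
  "(\<lambda>r. map (pos r n) xs) \<in> measurable draws (count_space UNIV)"
proof (induction xs)
  case (Cons x xs)
  note Cons [measurable]
  have "(\<lambda>r. a # map (pos r n) xs) \<in> measurable draws (count_space UNIV)" for a
    by (rule measurable_compose[OF Cons]) simp
  from measurable_compose_countable[where f = "\<lambda>a r. a # map (pos r n) xs", OF this measurable_pos]
  show ?case by simp
qed simp

lemma measurable_generic [measurable]: "Measurable.pred draws generic"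
proof -
  have "generic = (\<lambda>r. (\<forall>w::nat list. \<forall>m. \<exists>n. m \<le> n \<and> (\<forall>i<length w. r (i, n) = w ! i)) \<and>
     (\<forall>w::nat list. \<forall>x. x \<in> V \<longrightarrow> (\<forall>m. \<exists>i. m \<le> i \<and> col i = col x \<and> (\<forall>n<length w. r (i, n) = w ! n))))"
    by (auto simp: generic_def fun_eq_iff)
  then show ?thesis by simp
qed

text \<open>There are countably many requirements. Each one asks for a fixed pattern in one of
  infinitely many disjoint blocks: columns from \<open>m\<close> on for the first clause, rows of
  members of the class for the second.\<close>

lemma AE_generic: "AE r in draws. generic r"
proof -
  have "AE r in draws. \<exists>n\<ge>m. \<forall>i<length w. r (i, n) = w ! i" for w :: "nat list" and m
  proof -
    let ?Z = "\<lambda>k. (\<lambda>i. (i, m + k)) ` {..<length w}"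
    \<comment> \<open>The value 0 off the block keeps the bound \<open>sum_list w\<close> on the
      prescribed values valid at all coordinates.\<close>
    have "AE r in draws. \<exists>k. \<forall>q\<in>?Z k. r q = (if fst q < length w then w ! fst q else 0)"
    proof (rule AE_draws_block[where b = "length w" and m = "sum_list w"])
      show "card (?Z k) \<le> length w" for k using card_image_le[of "{..<length w}"] by simp
    qed (auto simp: disjoint_family_on_def intro: member_le_sum_list)
    then show ?thesis
    proof eventually_elim
      case (elim r)
      then obtain k where "\<forall>i<length w. r (i, m + k) = w ! i" by auto
      then show ?case by (intro exI[of _ "m + k"]) simp
    qed
  qed
  moreover have "AE r in draws. x \<in> V \<longrightarrow> (\<forall>m. \<exists>i\<ge>m. col i = col x \<and> (\<forall>n<length w. r (i, n) = w ! n))"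
    for w :: "nat list" and x
  proof (cases "x \<in> V")
    case True
    have "AE r in draws. \<exists>i\<ge>m. col i = col x \<and> (\<forall>n<length w. r (i, n) = w ! n)" for m
    proof -
      define C where "C = {y. col y = col x} - {..<m}"
      have inf: "infinite C" using True by (simp add: C_def V_eq)
      let ?Z = "\<lambda>k. (\<lambda>n. (enumerate C k, n)) ` {..<length w}"
      have "AE r in draws. \<exists>k. \<forall>q\<in>?Z k. r q = (if snd q < length w then w ! snd q else 0)"
      proof (rule AE_draws_block[where b = "length w" and m = "sum_list w"])
        show "card (?Z k) \<le> length w" for k using card_image_le[of "{..<length w}"] by simp
        show "disjoint_family ?Z"
          using strict_mono_enumerate[OF inf] by (auto simp: disjoint_family_on_def strict_mono_eq)
      qed (auto intro: member_le_sum_list)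
      then show ?thesis
      proof eventually_elim
        case (elim r)
        then obtain k where "\<forall>n<length w. r (enumerate C k, n) = w ! n" by auto
        moreover have "enumerate C k \<in> C" using enumerate_in_set[OF inf] .
        ultimately show ?case by (intro exI[of _ "enumerate C k"]) (auto simp: C_def)
      qed
    qed
    then show ?thesis by (simp add: AE_all_countable)
  qed simp
  ultimately show ?thesis
    unfolding generic_def Ball_def AE_conj_iff AE_all_countable by blast
qed

section \<open>The limit structure\<close>

text \<open>The positions need not converge. On a generic outcome the truth value of each relation
  on a tuple of positions is eventually constant, and this is what is recorded.\<close>

definition limit :: "('s \<Rightarrow> nat list set) \<Rightarrow> (nat \<times> nat \<Rightarrow> nat) \<Rightarrow> 's \<Rightarrow> nat list set" where
  "limit M r R = {xs. \<forall>\<^sub>F n in sequentially. map (pos r n) xs \<in> M R}"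

lemma limit_measurable: "{r. xs \<in> limit M r R} \<in> sets draws"
proof -
  have "Measurable.pred draws (\<lambda>r. \<exists>N. \<forall>n. N \<le> n \<longrightarrow> map (pos r n) xs \<in> M R)"
    by (intro pred_intros_countable pred_intros_imp' measurable_compose[OF measurable_map_pos]) simp
  then show ?thesis by (simp add: pred_def limit_def eventually_sequentially)
qed

lemma limit_reindex:
  assumes "bij g" "\<And>x. col (g x) = col x"
  shows "xs \<in> limit M (\<lambda>(i, n). r (g i, n)) R \<longleftrightarrow> map g xs \<in> limit M r R"
proof -
  have "pos (\<lambda>(i, n). r (g i, n)) n = pos r n \<circ> g" for n
    by (rule ext) (simp add: pos_reindex[OF assms])
  then show ?thesis by (simp add: limit_def)
qed

text \<open>Eventually the positions of a tuple are the image of \<open>map f xs\<close> under an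
  element of \<open>H\<close>, and \<open>H\<close> preserves \<open>M\<close>.\<close>

lemma limit_iso:
  assumes M: "\<forall>h\<in>H. \<forall>R xs. xs \<in> M R \<longleftrightarrow> map h xs \<in> M R" and r: "generic r"
  shows "\<exists>f. bij f \<and> (\<forall>x. col (f x) = col x) \<and> (\<forall>R xs. xs \<in> limit M r R \<longleftrightarrow> map f xs \<in> M R)"
proof -
  obtain f where f: "bij f" "\<forall>x. col (f x) = col x"
    and ev: "\<And>I. finite I \<Longrightarrow> \<forall>\<^sub>F n in sequentially. \<exists>h\<in>H. \<forall>i\<in>I. pos r n i = h (f i)"
    using ex_limit_bij[OF r] by blast
  have "xs \<in> limit M r R \<longleftrightarrow> map f xs \<in> M R" for R xs
  proof -
    have "\<forall>\<^sub>F n in sequentially. map (pos r n) xs \<in> M R \<longleftrightarrow> map f xs \<in> M R"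
      using ev[of "set xs", OF finite_set]
    proof eventually_elim
      case (elim n)
      then obtain h where h: "h \<in> H" "\<And>i. i \<in> set xs \<Longrightarrow> pos r n i = h (f i)" by blast
      then have "map (pos r n) xs = map h (map f xs)" by simp
      then show ?case using M[rule_format, OF h(1), of "map f xs" R] by (simp only:)
    qed
    from eventually_subst[OF this] show ?thesis
      by (simp add: limit_def)
  qed
  then show ?thesis using f by blast
qed

end

text \<open>Interface between the walks and the orbit: the tower is hidden, and \<open>E\<close> is
  the set of generic outcomes.\<close>

lemma (in movable_group) ex_random_copy:
  fixes M :: "'s \<Rightarrow> nat list set"
  assumes M: "\<forall>h\<in>H. \<forall>R xs. xs \<in> M R \<longleftrightarrow> map h xs \<in> M R"
  obtains N :: "(nat \<times> nat \<Rightarrow> nat) \<Rightarrow> 's \<Rightarrow> nat list set" and E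
  where "\<And>R xs. {r. xs \<in> N r R} \<in> sets draws"
    and "\<And>g r R xs. bij g \<Longrightarrow> \<forall>x. col (g x) = col x \<Longrightarrow>
      xs \<in> N (\<lambda>(i, n). r (g i, n)) R \<longleftrightarrow> map g xs \<in> N r R"
    and "E \<in> sets draws" "AE r in draws. r \<in> E"
    and "\<And>r. r \<in> E \<Longrightarrow> \<exists>f. bij f \<and> (\<forall>x. col (f x) = col x) \<and> (\<forall>R xs. xs \<in> N r R \<longleftrightarrow> map f xs \<in> M R)"
proof -
  obtain A d where Ad: "A 0 = {} \<and> (\<forall>n. finite (A n) \<and> A n \<subseteq> V \<and> A n \<subseteq> A (Suc n) \<and>
     duplicates (A n) (d n) \<and> d n ` A n \<subseteq> A (Suc n) \<and> (n \<in> V \<longrightarrow> n \<in> A (Suc n)) \<and>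
     (\<forall>j<n. \<forall>b\<in>V. \<forall>as. from_nat j = b # as \<longrightarrow> realizes (A n \<union> d n ` A n) as b (A (Suc n))))"
    using ex_tower by (elim exE) (rule that)
  interpret movable_tower col V H A d
  proof (intro movable_tower.intro movable_tower_axioms.intro)
    show "movable_group col V H" by (rule movable_group_axioms)
  qed (use Ad in \<open>simp_all only:\<close>)
  show thesis
  proof (rule that[of "limit M" "{r. generic r}"])
    show "{r. generic r} \<in> sets draws" using measurable_generic by (simp add: pred_def)
    show "AE r in draws. r \<in> {r. generic r}" using AE_generic by simp
    show "\<exists>f. bij f \<and> (\<forall>x. col (f x) = col x) \<and> (\<forall>R xs. xs \<in> limit M r R \<longleftrightarrow> map f xs \<in> M R)"
      if "r \<in> {r. generic r}" for r
      using limit_iso[OF M] that by simp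
  qed (use limit_measurable in \<open>simp_all add: limit_reindex\<close>)
qed

section \<open>The logic action and the structure on the orbit\<close>

lemma id_Aut: "id \<in> Aut M"
  by (simp add: Aut_def is_iso_def)

lemma comp_Aut: "f \<in> Aut M \<Longrightarrow> g \<in> Aut M \<Longrightarrow> f \<circ> g \<in> Aut M"
  by (auto simp: Aut_def is_iso_def bij_comp simp flip: map_map)

lemma inv_Aut:
  assumes "f \<in> Aut M"
  shows "inv f \<in> Aut M"
proof -
  have f: "bij f" "\<And>R xs. xs \<in> M R \<longleftrightarrow> map f xs \<in> M R" using assms by (auto simp: Aut_def is_iso_def)
  have "map f (map (inv f) xs) = xs" for xs
    using f(1) by (simp add: bij_is_surj map_idI surj_f_inv_f)
  then have "xs \<in> M R \<longleftrightarrow> map (inv f) xs \<in> M R" for R xs using f(2)[of "map (inv f) xs" R] by (simp only:)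
  then show ?thesis using f(1) by (simp add: Aut_def is_iso_def bij_imp_bij_inv)
qed

lemma Aut_reduct: "Aut M \<subseteq> Aut (reduct K M)"
  by (auto simp: Aut_def is_iso_def reduct_def)

lemma logic_act_comp:
  assumes "bij g" "bij h"
  shows "logic_act g (logic_act h N) = logic_act (g \<circ> h) N"
  by (simp add: logic_act_def o_inv_distrib[OF assms])

lemma logic_act_id: "logic_act id N = N"
  by (simp add: logic_act_def)

lemma logic_act_inv:
  assumes "bij g"
  shows "logic_act g (logic_act (inv g) N) = N" "logic_act (inv g) (logic_act g N) = N"
proof -
  have "g \<circ> inv g = id" "inv g \<circ> g = id"
    using bij_is_surj[OF assms] bij_is_inj[OF assms] by (simp_all add: surj_iff)
  then show "logic_act g (logic_act (inv g) N) = N" "logic_act (inv g) (logic_act g N) = N"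
    using assms bij_imp_bij_inv[OF assms] by (simp_all only: logic_act_comp logic_act_id)
qed

lemma bij_Aut: "f \<in> Aut M \<Longrightarrow> bij f"
  by (simp add: Aut_def is_iso_def)

lemma logic_act_Orb:
  assumes "M \<in> Str K A L" "g \<in> Aut A" "N \<in> Orb K A L M"
  shows "logic_act g N \<in> Orb K A L M"
  using assms comp_Aut[OF assms(2)] by (auto simp: Orb_eq_orbit logic_act_comp bij_Aut)

lemma space_Str_borel: "space (Str_borel K A L) = Str K A L"
  unfolding Str_borel_def by (rule space_measure_of) auto

lemma space_Orb_borel: "space (Orb_borel K A L M) = Orb K A L M"
  by (auto simp: Orb_borel_def space_restrict_space space_Str_borel Orb_def)

lemma measurable_Orb_borel:
  assumes Orb: "\<And>x. x \<in> space X \<Longrightarrow> N x \<in> Orb K A L M"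
    and meas: "\<And>R xs. L R = Some (length xs) \<Longrightarrow> {x \<in> space X. xs \<in> N x R} \<in> sets X"
  shows "N \<in> measurable X (Orb_borel K A L M)"
  unfolding Orb_borel_def
proof (rule measurable_restrict_space2)
  show "N \<in> space X \<rightarrow> Orb K A L M" using Orb by auto
  have Str: "N x \<in> Str K A L" if "x \<in> space X" for x using Orb[OF that] by (simp add: Orb_def)
  show "N \<in> measurable X (Str_borel K A L)"
    unfolding Str_borel_def
  proof (rule measurable_measure_of)
    show "N \<in> space X \<rightarrow> Str K A L" using Str by auto
    fix Y assume "Y \<in> {{N \<in> Str K A L. xs \<in> N R} | R xs. L R = Some (length xs)}"
    then obtain R xs where Y: "Y = {N \<in> Str K A L. xs \<in> N R}" "L R = Some (length xs)" by blast
    have "N -` Y \<inter> space X = {x \<in> space X. xs \<in> N x R}" using Str by (auto simp: Y)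
    then show "N -` Y \<inter> space X \<in> sets X" using meas Y(2) by simp
  qed auto
qed

lemma eval_Orb_borel:
  assumes "L R = Some (length xs)"
  shows "{N \<in> Orb K A L M. xs \<in> N R} \<in> sets (Orb_borel K A L M)"
proof -
  have "{N \<in> Str K A L. xs \<in> N R} \<in> sets (Str_borel K A L)"
    unfolding Str_borel_def using assms by (intro in_measure_of) auto
  moreover have "{N \<in> Orb K A L M. xs \<in> N R} = Orb K A L M \<inter> {N \<in> Str K A L. xs \<in> N R}"
    by (auto simp: Orb_def)
  ultimately show ?thesis by (auto simp: Orb_borel_def sets_restrict_space)
qed

lemma measurable_logic_act:
  assumes "M \<in> Str K A L" "g \<in> Aut A"
  shows "logic_act g \<in> measurable (Orb_borel K A L M) (Orb_borel K A L M)"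
proof (rule measurable_Orb_borel)
  show "logic_act g N \<in> Orb K A L M" if "N \<in> space (Orb_borel K A L M)" for N
    using that assms logic_act_Orb by (simp add: space_Orb_borel)
  show "{N \<in> space (Orb_borel K A L M). xs \<in> logic_act g N R} \<in> sets (Orb_borel K A L M)"
    if "L R = Some (length xs)" for R xs
    using eval_Orb_borel[of L R "map (inv g) xs"] that by (simp add: space_Orb_borel logic_act_def)
qed

text \<open>The image of \<open>X\<close> under \<open>g\<close> is its preimage under the inverse
  of \<open>g\<close>, so invariance of image measures, applied to \<open>inv g\<close>, gives
  invariance on sets.\<close>

lemma invariant_measureI:
  assumes M: "M \<in> Str K A L" and \<mu>: "sets \<mu> = sets (Orb_borel K A L M)"
    and inv: "\<And>g. g \<in> Aut A \<Longrightarrow> distr \<mu> (Orb_borel K A L M) (logic_act g) = \<mu>"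
  shows "invariant_measure (Aut A) \<mu>"
  unfolding invariant_measure_def
proof (intro ballI)
  fix g X assume g: "g \<in> Aut A" and X: "X \<in> sets \<mu>"
  have X': "X \<subseteq> Orb K A L M"
    using sets.sets_into_space[OF X] sets_eq_imp_space_eq[OF \<mu>] by (simp add: space_Orb_borel)
  have b: "bij g" "bij (inv g)" using g inv_Aut bij_Aut by blast+
  note gi = logic_act_inv[OF b(1)]
  have "logic_act g ` X = logic_act (inv g) -` X \<inter> Orb K A L M"
  proof (intro equalityI subsetI)
    fix N assume "N \<in> logic_act g ` X"
    then show "N \<in> logic_act (inv g) -` X \<inter> Orb K A L M"
      using X' logic_act_Orb[OF M g] by (auto simp: gi)
  next
    fix N assume "N \<in> logic_act (inv g) -` X \<inter> Orb K A L M"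
    then show "N \<in> logic_act g ` X" using gi(1)[of N] by (metis IntD1 image_eqI vimageD)
  qed
  then have "emeasure \<mu> (logic_act g ` X) = emeasure (distr \<mu> (Orb_borel K A L M) (logic_act (inv g))) X"
    using X measurable_logic_act[OF M inv_Aut[OF g]] sets_eq_imp_space_eq[OF \<mu>]
    by (subst emeasure_distr) (simp_all add: \<mu> space_Orb_borel cong: measurable_cong_sets)
  then show "emeasure \<mu> (logic_act g ` X) = emeasure \<mu> X"
    using inv[OF inv_Aut[OF g]] by simp
qed

section \<open>The classes of the \<open>U\<close>-predicates\<close>

text \<open>Serves as the colouring \<open>col\<close>. \<open>Vinf\<close> and \<open>Vfin\<close>
  are excluded because they overlap the other predicates; without them exactly one symbol holds of
  each point.\<close>

definition symbol_of :: "'r symb fstruct \<Rightarrow> nat \<Rightarrow> 'r symb" where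
  "symbol_of A x = (THE R. R \<notin> {Vinf, Vfin} \<and> x \<in> ext A R)"

context
  fixes linf lfin and A :: "'r symb fstruct"
  assumes A: "is_A_G linf lfin A"
begin

lemma ext_A_cases:
  assumes "x \<in> ext A R" "R \<notin> {Vinf, Vfin}"
  obtains i where "R = Uinf i" "i \<in> idx linf" | n i where "R = Ufin n i" "i \<in> idx (lfin n)"
proof -
  have "R \<in> dom (L_G linf lfin)"
    using A assms(1) by (auto simp: is_A_G_def is_struct_def ext_def)
  then show thesis using that assms(2) by (cases R) (auto simp: L_G_def split: if_splits)
qed

text \<open>Two predicates of the same kind are disjoint by assumption; a \<open>Uinf\<close> and a
  \<open>Ufin\<close> predicate lie in complementary sets.\<close>

lemma ext_A_unique:
  assumes R: "x \<in> ext A R" "R \<notin> {Vinf, Vfin}" and R': "x \<in> ext A R'" "R' \<notin> {Vinf, Vfin}"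
  shows "R = R'"
proof -
  have inf: "x \<in> ext A Vinf" if "x \<in> ext A (Uinf i)" "i \<in> idx linf" for i
    using A that by (auto simp: is_A_G_def)
  have fin: "x \<notin> ext A Vinf" if "x \<in> ext A (Ufin n i)" "i \<in> idx (lfin n)" for n i
  proof -
    have "ext A Vfin = (\<Union>n. \<Union>i\<in>idx (lfin n). ext A (Ufin n i))"
      using A unfolding is_A_G_def by (elim conjE)
    then have "x \<in> ext A Vfin" using that by blast
    moreover have "ext A Vfin = - ext A Vinf" using A unfolding is_A_G_def by (elim conjE)
    ultimately show ?thesis by blast
  qed
  have di: "i = j" if "x \<in> ext A (Uinf i)" "i \<in> idx linf" "x \<in> ext A (Uinf j)" "j \<in> idx linf" for i j
  proof (rule ccontr)
    assume "i \<noteq> j"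
    moreover have "disjoint_family_on (\<lambda>i. ext A (Uinf i)) (idx linf)"
      using A by (simp add: is_A_G_def)
    ultimately have "ext A (Uinf i) \<inter> ext A (Uinf j) = {}"
      using that(2,4) unfolding disjoint_family_on_def by blast
    then show False using that(1,3) by blast
  qed
  have df: "(m, i) = (n, j)"
    if "x \<in> ext A (Ufin m i)" "i \<in> idx (lfin m)" "x \<in> ext A (Ufin n j)" "j \<in> idx (lfin n)" for m n i j
  proof (rule ccontr)
    assume "(m, i) \<noteq> (n, j)"
    moreover have "disjoint_family_on (\<lambda>(n, i). ext A (Ufin n i)) (SIGMA n:UNIV. idx (lfin n))"
      using A by (simp add: is_A_G_def)
    ultimately have "ext A (Ufin m i) \<inter> ext A (Ufin n j) = {}"
      using that(2,4) unfolding disjoint_family_on_def by fastforce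
    then show False using that(1,3) by blast
  qed
  from R show ?thesis
  proof (cases rule: ext_A_cases)
    case (1 i)
    from R' show ?thesis
    proof (cases rule: ext_A_cases)
      case (1 j)
      then show ?thesis using \<open>R = Uinf i\<close> \<open>i \<in> idx linf\<close> R(1) R'(1) di by simp
    next
      case (2 n j)
      then show ?thesis using \<open>R = Uinf i\<close> \<open>i \<in> idx linf\<close> R(1) R'(1) inf fin by simp
    qed
  next
    case (2 n i)
    from R' show ?thesis
    proof (cases rule: ext_A_cases)
      case (1 j)
      then show ?thesis using \<open>R = Ufin n i\<close> \<open>i \<in> idx (lfin n)\<close> R(1) R'(1) inf fin by simp
    next
      case (2 m j)
      then show ?thesis using \<open>R = Ufin n i\<close> \<open>i \<in> idx (lfin n)\<close> R(1) R'(1) df by simp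
    qed
  qed
qed

lemma symbol_of_ext: "symbol_of A x \<notin> {Vinf, Vfin} \<and> x \<in> ext A (symbol_of A x)"
proof -
  have "\<exists>R. R \<notin> {Vinf, Vfin} \<and> x \<in> ext A R"
  proof (cases "x \<in> ext A Vinf")
    case True
    then obtain i where "x \<in> ext A (Uinf i)" using A by (auto simp: is_A_G_def)
    then show ?thesis by blast
  next
    case False
    moreover have "ext A Vfin = - ext A Vinf" using A unfolding is_A_G_def by (elim conjE)
    ultimately have "x \<in> ext A Vfin" by simp
    then obtain n i where "x \<in> ext A (Ufin n i)" using A by (auto simp: is_A_G_def)
    then show ?thesis by blast
  qed
  then have "\<exists>!R. R \<notin> {Vinf, Vfin} \<and> x \<in> ext A R" using ext_A_unique by blast
  from theI'[OF this] show ?thesis unfolding symbol_of_def .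
qed

lemma symbol_of_eq_iff: "R \<notin> {Vinf, Vfin} \<Longrightarrow> symbol_of A x = R \<longleftrightarrow> x \<in> ext A R"
  using symbol_of_ext ext_A_unique by blast

lemma symbol_of_class: "{y. symbol_of A y = symbol_of A x} = ext A (symbol_of A x)"
  using symbol_of_eq_iff[of "symbol_of A x"] symbol_of_ext[of x] by blast

text \<open>Supplies \<open>V_eq\<close>: the \<open>Uinf\<close> predicates are infinite, the
  \<open>Ufin\<close> predicates finite.\<close>

lemma infinite_class_iff: "infinite {y. symbol_of A y = symbol_of A x} \<longleftrightarrow> x \<notin> ext A Vfin"
proof -
  have compl: "ext A Vfin = - ext A Vinf" using A unfolding is_A_G_def by (elim conjE)
  have x: "x \<in> ext A (symbol_of A x)" "symbol_of A x \<notin> {Vinf, Vfin}" using symbol_of_ext by auto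
  then show ?thesis
  proof (cases rule: ext_A_cases)
    case (1 i)
    then have "x \<in> ext A Vinf" "infinite (ext A (symbol_of A x))"
      using A x(1) by (auto simp: is_A_G_def)
    then show ?thesis using compl by (simp add: symbol_of_class)
  next
    case (2 n i)
    then have "x \<in> ext A Vfin" "finite (ext A (symbol_of A x))"
      using A x(1) by (auto simp: is_A_G_def)
    then show ?thesis by (simp add: symbol_of_class)
  qed
qed

text \<open>Recasts the group as the class-preserving permutations, the condition under which the
  walks are equivariant.\<close>

lemma Aut_iff_symbol_of: "g \<in> Aut A \<longleftrightarrow> bij g \<and> (\<forall>x. symbol_of A (g x) = symbol_of A x)"
proof
  assume g: "g \<in> Aut A"
  then have "[y] \<in> A R \<longleftrightarrow> map g [y] \<in> A R" for y R
    unfolding Aut_def is_iso_def by blast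
  then have "y \<in> ext A R \<longleftrightarrow> g y \<in> ext A R" for y R
    by (simp add: ext_def)
  then show "bij g \<and> (\<forall>x. symbol_of A (g x) = symbol_of A x)"
    using g bij_Aut symbol_of_ext symbol_of_eq_iff by blast
next
  assume g: "bij g \<and> (\<forall>x. symbol_of A (g x) = symbol_of A x)"
  have "g ` ext A R = ext A R" if "R \<notin> {Vinf, Vfin}" for R
  proof -
    have "g x \<in> ext A R \<longleftrightarrow> x \<in> ext A R" for x
      using g symbol_of_eq_iff[OF that] by metis
    then have "g -` ext A R = ext A R" by auto
    then show ?thesis using surj_image_vimage_eq[of g "ext A R"] g by (simp add: bij_is_surj)
  qed
  then show "g \<in> Aut A" using g unfolding Aut_A_G_eq[OF A] by simp
qed

end

theorem proposition6p14:
  fixes linf :: enat and lfin :: "nat \<Rightarrow> enat"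
    and A :: "'r symb fstruct" and L :: "'r symb lang" and M :: "'r symb fstruct"
  assumes "is_A_G linf lfin A"
    and "L_G linf lfin \<subseteq>\<^sub>m L"
    and "countable (dom L)"
    and "M \<in> Str (L_G linf lfin) A L"
    and "almost_trivial_dcl A M"
  shows "\<exists>\<mu>. sets \<mu> = sets (Orb_borel (L_G linf lfin) A L M) \<and> prob_space \<mu> \<and> invariant_measure (Aut A) \<mu>"
proof -
  note A = assms(1) and M = assms(4)
  let ?K = "L_G linf lfin"
  let ?O = "Orb ?K A L M" and ?B = "Orb_borel ?K A L M"
  define H where "H = {h \<in> Aut M. \<forall>x\<in>ext A Vfin. h x = x}"
  have AutM: "Aut M \<subseteq> Aut A" using M Aut_reduct[of M ?K] by (simp add: Str_def)
  interpret movable_group "symbol_of A" "- ext A Vfin" H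
  proof
    show "- ext A Vfin = {x. infinite {y. symbol_of A y = symbol_of A x}}"
      using infinite_class_iff[OF A] by auto
    show "inv h \<in> H" if "h \<in> H" for h
    proof -
      have "inv h x = x" if "h x = x" for x
        using inv_f_f[OF bij_is_inj[OF bij_Aut[of h M]], of x] that \<open>h \<in> H\<close> by (simp add: H_def)
      then show ?thesis using that inv_Aut by (auto simp: H_def)
    qed
    show "symbol_of A (h x) = symbol_of A x" if "h \<in> H" for h x
      using that AutM Aut_iff_symbol_of[OF A] by (auto simp: H_def)
    show "\<exists>h\<in>H. (\<forall>x\<in>F. h x = x) \<and> h b \<noteq> b" if F: "finite F" "b \<in> - ext A Vfin" "b \<notin> F" for F b
    proof -
      obtain a where a: "set a = F" using F(1) finite_list by blast
      \<comment> \<open>A point outside the definable closure is moved by some automorphism fixing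
        \<open>F\<close> and V_fin pointwise, and that automorphism lies in
        \<open>H\<close>.\<close>
      have "b \<notin> dcl M (F \<union> ext A Vfin)"
        using assms(5) a F unfolding almost_trivial_dcl_def by blast
      then show ?thesis by (auto simp: dcl_def H_def)
    qed
  qed (auto simp: H_def id_Aut comp_Aut bij_Aut)
  have "\<forall>h\<in>H. \<forall>R xs. xs \<in> M R \<longleftrightarrow> map h xs \<in> M R"
    by (auto simp: H_def Aut_def is_iso_def)
  then obtain N :: "(nat \<times> nat \<Rightarrow> nat) \<Rightarrow> 'r symb fstruct" and E
    where meas: "\<And>R xs. {r. xs \<in> N r R} \<in> sets draws"
      and reindex: "\<And>g r R xs. bij g \<Longrightarrow> \<forall>x. symbol_of A (g x) = symbol_of A x \<Longrightarrow>
        xs \<in> N (\<lambda>(i, n). r (g i, n)) R \<longleftrightarrow> map g xs \<in> N r R"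
      and E: "E \<in> sets draws" "AE r in draws. r \<in> E"
      and iso: "\<And>r. r \<in> E \<Longrightarrow> \<exists>f. bij f \<and> (\<forall>x. symbol_of A (f x) = symbol_of A x) \<and>
        (\<forall>R xs. xs \<in> N r R \<longleftrightarrow> map f xs \<in> M R)"
    by (rule ex_random_copy) (rule that)
  \<comment> \<open>Outside \<open>E\<close> the value is reset to \<open>M\<close>, so that every
    outcome gives a member of the orbit.\<close>
  define N' where "N' r = (if r \<in> E then N r else M)" for r
  have Orb: "N' r \<in> ?O" for r
  proof (cases "r \<in> E")
    case True
    then obtain f where f: "bij f" "\<forall>x. symbol_of A (f x) = symbol_of A x"
      "\<And>R xs. xs \<in> N r R \<longleftrightarrow> map f xs \<in> M R" using iso by blast
    then have "inv f \<in> Aut A" using Aut_iff_symbol_of[OF A] inv_Aut by blast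
    moreover have "N r = logic_act (inv f) M"
      using f by (auto simp: logic_act_def inv_inv_eq)
    ultimately show ?thesis using True unfolding Orb_eq_orbit[OF M] N'_def by simp
  next
    case False
    have "logic_act id M \<in> ?O" unfolding Orb_eq_orbit[OF M] using id_Aut by blast
    then show ?thesis using False by (simp add: N'_def logic_act_id)
  qed
  have N': "N' \<in> measurable draws ?B"
  proof (rule measurable_Orb_borel)
    fix R and xs :: "nat list"
    have "{r. xs \<in> N' r R} = (E \<inter> {r. xs \<in> N r R}) \<union> ((space draws - E) \<inter> {r. xs \<in> M R})"
      by (auto simp: N'_def)
    moreover have "{r. xs \<in> M R} \<in> sets draws"
      by (cases "xs \<in> M R") (use sets.top[of draws] in auto)
    ultimately show "{r \<in> space draws. xs \<in> N' r R} \<in> sets draws" using meas E(1) by auto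
  qed (rule Orb)
  let ?\<mu> = "distr draws ?B N'"
  have "invariant_measure (Aut A) ?\<mu>"
  proof (rule invariant_measureI[OF M])
    fix g assume g: "g \<in> Aut A"
    let ?g = "inv g"
    have ig: "?g \<in> Aut A" using inv_Aut[OF g] .
    \<comment> \<open>The rows are relabelled by the inverse of \<open>g\<close> because the logic
      action evaluates relations at preimages.\<close>
    define \<rho> :: "(nat \<times> nat \<Rightarrow> nat) \<Rightarrow> _" where "\<rho> r = (\<lambda>q. r (map_prod ?g id q))" for r
    have \<rho>_eq: "\<rho> r = (\<lambda>(i, n). r (?g i, n))" for r by (auto simp: \<rho>_def)
    have \<rho>[measurable]: "\<rho> \<in> measurable draws draws"
      unfolding \<rho>_def by (rule measurable_draws_comp)
    have inj: "inj (map_prod ?g id)" using bij_Aut[OF ig] by (simp add: bij_is_inj prod.inj_map)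
    have distr_\<rho>: "distr draws draws \<rho> = draws"
      unfolding \<rho>_def by (rule distr_draws_reindex[OF inj])
    \<comment> \<open>Since relabelling keeps the law, \<open>\<rho> r\<close> lies in
      \<open>E\<close> almost surely as well; the case distinction in \<open>N'\<close> then falls
      on the same side for \<open>r\<close> and \<open>\<rho> r\<close>.\<close>
    have "AE r in distr draws draws \<rho>. r \<in> E" unfolding distr_\<rho> by (rule E(2))
    then have "AE r in draws. \<rho> r \<in> E" by (rule AE_distrD[OF \<rho>])
    with E(2) have AE: "AE r in draws. logic_act g (N' r) = N' (\<rho> r)"
    proof eventually_elim
      case (elim r)
      have "xs \<in> N (\<rho> r) R \<longleftrightarrow> map ?g xs \<in> N r R" for xs R
        unfolding \<rho>_eq using ig Aut_iff_symbol_of[OF A] by (intro reindex) auto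
      then show ?case using elim by (auto simp: logic_act_def N'_def fun_eq_iff set_eq_iff)
    qed
    have act: "logic_act g \<in> measurable ?B ?B" by (rule measurable_logic_act[OF M g])
    \<comment> \<open>Acting by \<open>g\<close> is almost surely the same as relabelling the draws,
      which leaves their law unchanged.\<close>
    have "distr ?\<mu> ?B (logic_act g) = distr draws ?B (logic_act g \<circ> N')"
      by (rule distr_distr[OF act N'])
    also have "\<dots> = distr draws ?B (N' \<circ> \<rho>)"
      using AE N' act \<rho> by (intro distr_cong_AE) (auto intro: measurable_comp)
    also have "\<dots> = ?\<mu>"
      using distr_distr[OF N' \<rho>] distr_\<rho> by simp
    finally show "distr ?\<mu> ?B (logic_act g) = ?\<mu>" .
  qed simp
  moreover have "prob_space ?\<mu>"
    using N' by (rule draws.prob_space_distr)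
  ultimately show ?thesis by (intro exI[of _ ?\<mu>]) simp
qed

end
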